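(* There is an arithmetical sentence that is extremely independent from $\mathsf{PA}$.
   Context: $\mathsf{PA}$ is Peano Arithmetic. $x:F$ denotes the standard arithmetical proof predicate of $\mathsf{PA}$ ("$x$ is a code of a proof in $\mathsf{PA}$ of $F$"), and $\Box F$ denotes the standard provability predicate $\exists x\,(x:F)$. $\Box^n$ is the $n$-fold iteration of $\Box$. An arithmetical sentence is constructively true if it is provable in $\mathsf{PA}$. For $n\geq 1$, put $cf^n(F)=\forall x\,\Box^n\neg(x:F)$ (inside $\Box$ the variable $x$ stands for its numeral); an arithmetical sentence $A$ is $n$-constructively false if $\mathsf{PA}$ proves $cf^n(A)$. An arithmetical sentence $A$ is strongly independent from $\mathsf{PA}$ if it is neither constructively true nor $n$-constructively false for any $n\geq 1$. $A$ is extremely independent from $\mathsf{PA}$ if both $A$ and $\neg A$ are strongly independent from $\mathsf{PA}$. *)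

theory Defs
  imports "HOL-Number_Theory.Cong"
begin

section \<open>The language of arithmetic\<close>

text \<open>Variables are de Bruijn indices; negation, conjunction, disjunction and the existential
  quantifier are abbreviations, since the underlying logic is classical.\<close>

datatype trm = Zero | Var nat | Succ trm | Add trm trm | Mul trm trm

datatype fm =
    Eq trm trm  (infix "\<^bold>=" 57)
  | Falsity
  | Imp fm fm  (infixr "\<^bold>\<longrightarrow>" 51)
  | Forall fm

definition Neg :: "fm \<Rightarrow> fm" where
  "Neg p = (p \<^bold>\<longrightarrow> Falsity)"

definition And :: "fm \<Rightarrow> fm \<Rightarrow> fm"  (infixr "\<^bold>\<and>" 55) where
  "(p \<^bold>\<and> q) = Neg (p \<^bold>\<longrightarrow> Neg q)"

definition Or :: "fm \<Rightarrow> fm \<Rightarrow> fm"  (infixr "\<^bold>\<or>" 53) where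
  "(p \<^bold>\<or> q) = (Neg p \<^bold>\<longrightarrow> q)"

definition Ex :: "fm \<Rightarrow> fm" where
  "Ex p = Neg (Forall (Neg p))"

primrec closed_trm :: "nat \<Rightarrow> trm \<Rightarrow> bool" where
  "closed_trm k Zero \<longleftrightarrow> True"
| "closed_trm k (Var n) \<longleftrightarrow> n < k"
| "closed_trm k (Succ t) \<longleftrightarrow> closed_trm k t"
| "closed_trm k (Add s t) \<longleftrightarrow> closed_trm k s \<and> closed_trm k t"
| "closed_trm k (Mul s t) \<longleftrightarrow> closed_trm k s \<and> closed_trm k t"

primrec closed_fm :: "nat \<Rightarrow> fm \<Rightarrow> bool" where
  "closed_fm k (s \<^bold>= t) \<longleftrightarrow> closed_trm k s \<and> closed_trm k t"
| "closed_fm k Falsity \<longleftrightarrow> True"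
| "closed_fm k (p \<^bold>\<longrightarrow> q) \<longleftrightarrow> closed_fm k p \<and> closed_fm k q"
| "closed_fm k (Forall p) \<longleftrightarrow> closed_fm (Suc k) p"

definition sentence :: "fm \<Rightarrow> bool" where
  "sentence p \<longleftrightarrow> closed_fm 0 p"

text \<open>\<open>lift_trm k\<close> and \<open>lift_fm k\<close> make room for a new variable with index \<open>k\<close>;
  \<open>subst_trm k s\<close> and \<open>subst_fm k s\<close> replace the variable \<open>k\<close> by \<open>s\<close> and remove its index.\<close>

primrec lift_trm :: "nat \<Rightarrow> trm \<Rightarrow> trm" where
  "lift_trm k Zero = Zero"
| "lift_trm k (Var n) = (if n < k then Var n else Var (Suc n))"
| "lift_trm k (Succ t) = Succ (lift_trm k t)"
| "lift_trm k (Add s t) = Add (lift_trm k s) (lift_trm k t)"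
| "lift_trm k (Mul s t) = Mul (lift_trm k s) (lift_trm k t)"

primrec lift_fm :: "nat \<Rightarrow> fm \<Rightarrow> fm" where
  "lift_fm k (s \<^bold>= t) = (lift_trm k s \<^bold>= lift_trm k t)"
| "lift_fm k Falsity = Falsity"
| "lift_fm k (p \<^bold>\<longrightarrow> q) = (lift_fm k p \<^bold>\<longrightarrow> lift_fm k q)"
| "lift_fm k (Forall p) = Forall (lift_fm (Suc k) p)"

primrec subst_trm :: "nat \<Rightarrow> trm \<Rightarrow> trm \<Rightarrow> trm" where
  "subst_trm k s Zero = Zero"
| "subst_trm k s (Var n) = (if n < k then Var n else if n = k then s else Var (n - 1))"
| "subst_trm k s (Succ t) = Succ (subst_trm k s t)"
| "subst_trm k s (Add t u) = Add (subst_trm k s t) (subst_trm k s u)"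
| "subst_trm k s (Mul t u) = Mul (subst_trm k s t) (subst_trm k s u)"

primrec subst_fm :: "nat \<Rightarrow> trm \<Rightarrow> fm \<Rightarrow> fm" where
  "subst_fm k s (t \<^bold>= u) = (subst_trm k s t \<^bold>= subst_trm k s u)"
| "subst_fm k s Falsity = Falsity"
| "subst_fm k s (p \<^bold>\<longrightarrow> q) = (subst_fm k s p \<^bold>\<longrightarrow> subst_fm k s q)"
| "subst_fm k s (Forall p) = Forall (subst_fm (Suc k) (lift_trm 0 s) p)"

primrec num_trm :: "nat \<Rightarrow> trm" where
  "num_trm 0 = Zero"
| "num_trm (Suc n) = Succ (num_trm n)"


section \<open>Peano Arithmetic\<close>

text \<open>Equality axioms and the defining axioms of successor, addition and multiplication, as open
  formulas; their closures follow by generalization.\<close>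

definition basic_axioms :: "fm list" where
  "basic_axioms =
    [Var 0 \<^bold>= Var 0,
     Var 0 \<^bold>= Var 1 \<^bold>\<longrightarrow> Var 0 \<^bold>= Var 2 \<^bold>\<longrightarrow> Var 1 \<^bold>= Var 2,
     Var 0 \<^bold>= Var 1 \<^bold>\<longrightarrow> Succ (Var 0) \<^bold>= Succ (Var 1),
     Var 0 \<^bold>= Var 1 \<^bold>\<longrightarrow> Var 2 \<^bold>= Var 3 \<^bold>\<longrightarrow> Add (Var 0) (Var 2) \<^bold>= Add (Var 1) (Var 3),
     Var 0 \<^bold>= Var 1 \<^bold>\<longrightarrow> Var 2 \<^bold>= Var 3 \<^bold>\<longrightarrow> Mul (Var 0) (Var 2) \<^bold>= Mul (Var 1) (Var 3),
     Neg (Succ (Var 0) \<^bold>= Zero),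
     Succ (Var 0) \<^bold>= Succ (Var 1) \<^bold>\<longrightarrow> Var 0 \<^bold>= Var 1,
     Add (Var 0) Zero \<^bold>= Var 0,
     Add (Var 0) (Succ (Var 1)) \<^bold>= Succ (Add (Var 0) (Var 1)),
     Mul (Var 0) Zero \<^bold>= Zero,
     Mul (Var 0) (Succ (Var 1)) \<^bold>= Add (Mul (Var 0) (Var 1)) (Var 0)]"

text \<open>A Hilbert-style axiomatization with rules modus ponens and generalization.  In \<open>Dist\<close>,
  lifting \<open>p\<close> expresses that the quantified variable is not free in \<open>p\<close>.  In \<open>Ind\<close>,
  \<open>subst_fm 0 (Succ (Var 0)) (lift_fm 1 p)\<close> is \<open>p(x + 1)\<close>, still with index 0 for \<open>x\<close>.\<close>

inductive PA_axiom :: "fm \<Rightarrow> bool" where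
  K: "PA_axiom (p \<^bold>\<longrightarrow> q \<^bold>\<longrightarrow> p)"
| S: "PA_axiom ((p \<^bold>\<longrightarrow> q \<^bold>\<longrightarrow> r) \<^bold>\<longrightarrow> (p \<^bold>\<longrightarrow> q) \<^bold>\<longrightarrow> p \<^bold>\<longrightarrow> r)"
| DN: "PA_axiom (((p \<^bold>\<longrightarrow> Falsity) \<^bold>\<longrightarrow> Falsity) \<^bold>\<longrightarrow> p)"
| Inst: "PA_axiom (Forall p \<^bold>\<longrightarrow> subst_fm 0 t p)"
| Dist: "PA_axiom (Forall (lift_fm 0 p \<^bold>\<longrightarrow> q) \<^bold>\<longrightarrow> p \<^bold>\<longrightarrow> Forall q)"
| Basic: "p \<in> set basic_axioms \<Longrightarrow> PA_axiom p"
| Ind: "PA_axiom (subst_fm 0 Zero p \<^bold>\<longrightarrow>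
      Forall (p \<^bold>\<longrightarrow> subst_fm 0 (Succ (Var 0)) (lift_fm 1 p)) \<^bold>\<longrightarrow> Forall p)"

inductive PA_proves :: "fm \<Rightarrow> bool"  ("PA \<turnstile> _" [40] 40) where
  Ax: "PA_axiom p \<Longrightarrow> PA \<turnstile> p"
| MP: "PA \<turnstile> p \<^bold>\<longrightarrow> q \<Longrightarrow> PA \<turnstile> p \<Longrightarrow> PA \<turnstile> q"
| Gen: "PA \<turnstile> p \<Longrightarrow> PA \<turnstile> Forall p"


section \<open>Goedel numbering\<close>

text \<open>An injective pairing function that is a polynomial, hence given by a term of the language.\<close>

definition pair :: "nat \<Rightarrow> nat \<Rightarrow> nat" where
  "pair x y = (x + y) * (x + y) + x"

primrec code_trm :: "trm \<Rightarrow> nat" where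
  "code_trm Zero = pair 1 0"
| "code_trm (Var n) = pair 2 n"
| "code_trm (Succ t) = pair 3 (code_trm t)"
| "code_trm (Add s t) = pair 4 (pair (code_trm s) (code_trm t))"
| "code_trm (Mul s t) = pair 5 (pair (code_trm s) (code_trm t))"

primrec code_fm :: "fm \<Rightarrow> nat" where
  "code_fm (s \<^bold>= t) = pair 6 (pair (code_trm s) (code_trm t))"
| "code_fm Falsity = pair 7 0"
| "code_fm (p \<^bold>\<longrightarrow> q) = pair 8 (pair (code_fm p) (code_fm q))"
| "code_fm (Forall p) = pair 9 (code_fm p)"

definition quote_trm :: "trm \<Rightarrow> trm" where
  "quote_trm t = num_trm (code_trm t)"

definition quote_fm :: "fm \<Rightarrow> trm"  ("\<lceil>_\<rceil>") where
  "\<lceil>p\<rceil> = num_trm (code_fm p)"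


section \<open>Arithmetization of the syntax\<close>

text \<open>The functions below build formulas of arithmetic from terms of arithmetic.  \<open>ex1 f\<close> etc. bind
  new variables and hand them to \<open>f\<close>; a term that comes from outside \<open>n\<close> new quantifiers has to be
  wrapped in \<open>up n\<close>.\<close>

definition up :: "nat \<Rightarrow> trm \<Rightarrow> trm" where
  "up n t = (lift_trm 0 ^^ n) t"

definition ex1 :: "(trm \<Rightarrow> fm) \<Rightarrow> fm" where
  "ex1 f = Ex (f (Var 0))"

definition ex2 :: "(trm \<Rightarrow> trm \<Rightarrow> fm) \<Rightarrow> fm" where
  "ex2 f = Ex (Ex (f (Var 1) (Var 0)))"

definition ex3 :: "(trm \<Rightarrow> trm \<Rightarrow> trm \<Rightarrow> fm) \<Rightarrow> fm" where
  "ex3 f = Ex (Ex (Ex (f (Var 2) (Var 1) (Var 0))))"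

definition ex4 :: "(trm \<Rightarrow> trm \<Rightarrow> trm \<Rightarrow> trm \<Rightarrow> fm) \<Rightarrow> fm" where
  "ex4 f = Ex (Ex (Ex (Ex (f (Var 3) (Var 2) (Var 1) (Var 0)))))"

definition ex5 :: "(trm \<Rightarrow> trm \<Rightarrow> trm \<Rightarrow> trm \<Rightarrow> trm \<Rightarrow> fm) \<Rightarrow> fm" where
  "ex5 f = Ex (Ex (Ex (Ex (Ex (f (Var 4) (Var 3) (Var 2) (Var 1) (Var 0))))))"

definition ex6 :: "(trm \<Rightarrow> trm \<Rightarrow> trm \<Rightarrow> trm \<Rightarrow> trm \<Rightarrow> trm \<Rightarrow> fm) \<Rightarrow> fm" where
  "ex6 f = Ex (Ex (Ex (Ex (Ex (Ex (f (Var 5) (Var 4) (Var 3) (Var 2) (Var 1) (Var 0)))))))"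

definition disj :: "fm list \<Rightarrow> fm" where
  "disj ps = foldr Or ps Falsity"

definition leq_fm :: "trm \<Rightarrow> trm \<Rightarrow> fm"  (infix "\<^bold>\<le>" 57) where
  "(s \<^bold>\<le> t) = ex1 (\<lambda>d. up 1 t \<^bold>= Add (up 1 s) d)"

definition less_fm :: "trm \<Rightarrow> trm \<Rightarrow> fm"  (infix "\<^bold><" 57) where
  "(s \<^bold>< t) = (Succ s \<^bold>\<le> t)"

definition all_leq :: "trm \<Rightarrow> (trm \<Rightarrow> fm) \<Rightarrow> fm" where
  "all_leq n f = Forall (Var 0 \<^bold>\<le> up 1 n \<^bold>\<longrightarrow> f (Var 0))"

definition tpair :: "trm \<Rightarrow> trm \<Rightarrow> trm"  ("\<langle>_, _\<rangle>") where
  "\<langle>s, t\<rangle> = Add (Mul (Add s t) (Add s t)) s"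

definition tZero :: trm where "tZero = \<langle>num_trm 1, num_trm 0\<rangle>"
definition tVar :: "trm \<Rightarrow> trm" where "tVar n = \<langle>num_trm 2, n\<rangle>"
definition tSucc :: "trm \<Rightarrow> trm" where "tSucc t = \<langle>num_trm 3, t\<rangle>"
definition tAdd :: "trm \<Rightarrow> trm \<Rightarrow> trm" where "tAdd s t = \<langle>num_trm 4, \<langle>s, t\<rangle>\<rangle>"
definition tMul :: "trm \<Rightarrow> trm \<Rightarrow> trm" where "tMul s t = \<langle>num_trm 5, \<langle>s, t\<rangle>\<rangle>"
definition tEq :: "trm \<Rightarrow> trm \<Rightarrow> trm" where "tEq s t = \<langle>num_trm 6, \<langle>s, t\<rangle>\<rangle>"
definition tFalsity :: trm where "tFalsity = \<langle>num_trm 7, num_trm 0\<rangle>"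
definition tImp :: "trm \<Rightarrow> trm \<Rightarrow> trm" where "tImp p q = \<langle>num_trm 8, \<langle>p, q\<rangle>\<rangle>"
definition tForall :: "trm \<Rightarrow> trm" where "tForall p = \<langle>num_trm 9, p\<rangle>"

text \<open>Goedel's beta function: \<open>z = a mod (1 + (i + 1) * b)\<close>.  The pair \<open>a, b\<close> codes the
  sequence of these values for \<open>i = 0, 1, ...\<close>.\<close>

definition beta_fm :: "trm \<Rightarrow> trm \<Rightarrow> trm \<Rightarrow> trm \<Rightarrow> fm" where
  "beta_fm a b i z = (z \<^bold>\<le> Mul (Succ i) b) \<^bold>\<and>
     ex1 (\<lambda>q. up 1 a \<^bold>= Add (Mul q (Succ (Mul (Succ (up 1 i)) (up 1 b)))) (up 1 z))"

text \<open>\<open>before a b i u\<close>: the value \<open>u\<close> occurs at a position smaller than \<open>i\<close>.\<close>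

definition before :: "trm \<Rightarrow> trm \<Rightarrow> trm \<Rightarrow> trm \<Rightarrow> fm" where
  "before a b i u = ex1 (\<lambda>j. (j \<^bold>< up 1 i) \<^bold>\<and> beta_fm (up 1 a) (up 1 b) j (up 1 u))"

text \<open>\<open>constr_seq step a b n\<close>: every entry \<open>z\<close> of the sequence \<open>a, b\<close> at a position \<open>i\<close> up to \<open>n\<close>
  satisfies \<open>step a b i z\<close>, which is going to say that \<open>z\<close> arises from entries before \<open>i\<close> by a
  construction step.  \<open>constructible step x\<close>: the value \<open>x\<close> is the last entry of such a sequence.\<close>

definition constr_seq :: "(trm \<Rightarrow> trm \<Rightarrow> trm \<Rightarrow> trm \<Rightarrow> fm) \<Rightarrow> trm \<Rightarrow> trm \<Rightarrow> trm \<Rightarrow> fm" where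
  "constr_seq step a b n = all_leq n (\<lambda>i. ex1 (\<lambda>z.
     beta_fm (up 2 a) (up 2 b) (up 1 i) z \<^bold>\<and> step (up 2 a) (up 2 b) (up 1 i) z))"

definition constructible :: "(trm \<Rightarrow> trm \<Rightarrow> trm \<Rightarrow> trm \<Rightarrow> fm) \<Rightarrow> trm \<Rightarrow> fm" where
  "constructible step x = ex3 (\<lambda>a b n. beta_fm a b n (up 3 x) \<^bold>\<and> constr_seq step a b n)"

definition is_trm_step :: "trm \<Rightarrow> trm \<Rightarrow> trm \<Rightarrow> trm \<Rightarrow> fm" where
  "is_trm_step a b i z = disj
    [z \<^bold>= tZero,
     ex1 (\<lambda>n. up 1 z \<^bold>= tVar n),
     ex1 (\<lambda>t. before (up 1 a) (up 1 b) (up 1 i) t \<^bold>\<and> up 1 z \<^bold>= tSucc t),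
     ex2 (\<lambda>s t. before (up 2 a) (up 2 b) (up 2 i) s \<^bold>\<and> before (up 2 a) (up 2 b) (up 2 i) t \<^bold>\<and>
       (up 2 z \<^bold>= tAdd s t \<^bold>\<or> up 2 z \<^bold>= tMul s t))]"

definition is_trm_fm :: "trm \<Rightarrow> fm" where
  "is_trm_fm x = constructible is_trm_step x"

definition is_fm_step :: "trm \<Rightarrow> trm \<Rightarrow> trm \<Rightarrow> trm \<Rightarrow> fm" where
  "is_fm_step a b i z = disj
    [ex2 (\<lambda>s t. is_trm_fm s \<^bold>\<and> is_trm_fm t \<^bold>\<and> up 2 z \<^bold>= tEq s t),
     z \<^bold>= tFalsity,
     ex2 (\<lambda>p q. before (up 2 a) (up 2 b) (up 2 i) p \<^bold>\<and> before (up 2 a) (up 2 b) (up 2 i) q \<^bold>\<and>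
       up 2 z \<^bold>= tImp p q),
     ex1 (\<lambda>p. before (up 1 a) (up 1 b) (up 1 i) p \<^bold>\<and> up 1 z \<^bold>= tForall p)]"

definition is_fm_fm :: "trm \<Rightarrow> fm" where
  "is_fm_fm x = constructible is_fm_step x"

text \<open>The graphs of lifting and substitution, for terms and formulas at once; the entries of the
  construction sequences are the tuples \<open>\<langle>k, \<langle>x, y\<rangle>\<rangle>\<close> and \<open>\<langle>k, \<langle>s, \<langle>x, y\<rangle>\<rangle>\<rangle>\<close>, respectively, where
  \<open>y\<close> is the result of the operation on \<open>x\<close>.\<close>

definition lift_step :: "trm \<Rightarrow> trm \<Rightarrow> trm \<Rightarrow> trm \<Rightarrow> fm" where
  "lift_step a b i z = disj
    [ex1 (\<lambda>k. up 1 z \<^bold>= \<langle>k, \<langle>tZero, tZero\<rangle>\<rangle>),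
     ex2 (\<lambda>k n. n \<^bold>< k \<^bold>\<and> up 2 z \<^bold>= \<langle>k, \<langle>tVar n, tVar n\<rangle>\<rangle>),
     ex2 (\<lambda>k n. k \<^bold>\<le> n \<^bold>\<and> up 2 z \<^bold>= \<langle>k, \<langle>tVar n, tVar (Succ n)\<rangle>\<rangle>),
     ex3 (\<lambda>k x y. before (up 3 a) (up 3 b) (up 3 i) \<langle>k, \<langle>x, y\<rangle>\<rangle> \<^bold>\<and>
       up 3 z \<^bold>= \<langle>k, \<langle>tSucc x, tSucc y\<rangle>\<rangle>),
     ex5 (\<lambda>k x y x' y'. before (up 5 a) (up 5 b) (up 5 i) \<langle>k, \<langle>x, y\<rangle>\<rangle> \<^bold>\<and>
       before (up 5 a) (up 5 b) (up 5 i) \<langle>k, \<langle>x', y'\<rangle>\<rangle> \<^bold>\<and>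
       disj [up 5 z \<^bold>= \<langle>k, \<langle>tAdd x x', tAdd y y'\<rangle>\<rangle>, up 5 z \<^bold>= \<langle>k, \<langle>tMul x x', tMul y y'\<rangle>\<rangle>,
             up 5 z \<^bold>= \<langle>k, \<langle>tEq x x', tEq y y'\<rangle>\<rangle>, up 5 z \<^bold>= \<langle>k, \<langle>tImp x x', tImp y y'\<rangle>\<rangle>]),
     ex1 (\<lambda>k. up 1 z \<^bold>= \<langle>k, \<langle>tFalsity, tFalsity\<rangle>\<rangle>),
     ex3 (\<lambda>k x y. before (up 3 a) (up 3 b) (up 3 i) \<langle>Succ k, \<langle>x, y\<rangle>\<rangle> \<^bold>\<and>
       up 3 z \<^bold>= \<langle>k, \<langle>tForall x, tForall y\<rangle>\<rangle>)]"

definition lift_graph :: "trm \<Rightarrow> trm \<Rightarrow> trm \<Rightarrow> fm" where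
  "lift_graph k x y = constructible lift_step \<langle>k, \<langle>x, y\<rangle>\<rangle>"

definition subst_step :: "trm \<Rightarrow> trm \<Rightarrow> trm \<Rightarrow> trm \<Rightarrow> fm" where
  "subst_step a b i z = disj
    [ex2 (\<lambda>k s. up 2 z \<^bold>= \<langle>k, \<langle>s, \<langle>tZero, tZero\<rangle>\<rangle>\<rangle>),
     ex3 (\<lambda>k s n. n \<^bold>< k \<^bold>\<and> up 3 z \<^bold>= \<langle>k, \<langle>s, \<langle>tVar n, tVar n\<rangle>\<rangle>\<rangle>),
     ex2 (\<lambda>k s. up 2 z \<^bold>= \<langle>k, \<langle>s, \<langle>tVar k, s\<rangle>\<rangle>\<rangle>),
     ex3 (\<lambda>k s n. k \<^bold>\<le> n \<^bold>\<and> up 3 z \<^bold>= \<langle>k, \<langle>s, \<langle>tVar (Succ n), tVar n\<rangle>\<rangle>\<rangle>),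
     ex4 (\<lambda>k s x y. before (up 4 a) (up 4 b) (up 4 i) \<langle>k, \<langle>s, \<langle>x, y\<rangle>\<rangle>\<rangle> \<^bold>\<and>
       up 4 z \<^bold>= \<langle>k, \<langle>s, \<langle>tSucc x, tSucc y\<rangle>\<rangle>\<rangle>),
     ex6 (\<lambda>k s x y x' y'. before (up 6 a) (up 6 b) (up 6 i) \<langle>k, \<langle>s, \<langle>x, y\<rangle>\<rangle>\<rangle> \<^bold>\<and>
       before (up 6 a) (up 6 b) (up 6 i) \<langle>k, \<langle>s, \<langle>x', y'\<rangle>\<rangle>\<rangle> \<^bold>\<and>
       disj [up 6 z \<^bold>= \<langle>k, \<langle>s, \<langle>tAdd x x', tAdd y y'\<rangle>\<rangle>\<rangle>, up 6 z \<^bold>= \<langle>k, \<langle>s, \<langle>tMul x x', tMul y y'\<rangle>\<rangle>\<rangle>,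
             up 6 z \<^bold>= \<langle>k, \<langle>s, \<langle>tEq x x', tEq y y'\<rangle>\<rangle>\<rangle>, up 6 z \<^bold>= \<langle>k, \<langle>s, \<langle>tImp x x', tImp y y'\<rangle>\<rangle>\<rangle>]),
     ex2 (\<lambda>k s. up 2 z \<^bold>= \<langle>k, \<langle>s, \<langle>tFalsity, tFalsity\<rangle>\<rangle>\<rangle>),
     ex5 (\<lambda>k s s' x y. lift_graph Zero s s' \<^bold>\<and>
       before (up 5 a) (up 5 b) (up 5 i) \<langle>Succ k, \<langle>s', \<langle>x, y\<rangle>\<rangle>\<rangle> \<^bold>\<and>
       up 5 z \<^bold>= \<langle>k, \<langle>s, \<langle>tForall x, tForall y\<rangle>\<rangle>\<rangle>)]"

definition subst_graph :: "trm \<Rightarrow> trm \<Rightarrow> trm \<Rightarrow> trm \<Rightarrow> fm" where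
  "subst_graph k s x y = constructible subst_step \<langle>k, \<langle>s, \<langle>x, y\<rangle>\<rangle>\<rangle>"

text \<open>\<open>num_graph n y\<close>: the value \<open>y\<close> is the code of the numeral of \<open>n\<close>.\<close>

definition num_step :: "trm \<Rightarrow> trm \<Rightarrow> trm \<Rightarrow> trm \<Rightarrow> fm" where
  "num_step a b i z = disj
    [z \<^bold>= \<langle>Zero, tZero\<rangle>,
     ex2 (\<lambda>n y. before (up 2 a) (up 2 b) (up 2 i) \<langle>n, y\<rangle> \<^bold>\<and> up 2 z \<^bold>= \<langle>Succ n, tSucc y\<rangle>)]"

definition num_graph :: "trm \<Rightarrow> trm \<Rightarrow> fm" where
  "num_graph n y = constructible num_step \<langle>n, y\<rangle>"

definition axiom_fm :: "trm \<Rightarrow> fm" where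
  "axiom_fm z = disj
    [ex2 (\<lambda>p q. is_fm_fm p \<^bold>\<and> is_fm_fm q \<^bold>\<and> up 2 z \<^bold>= tImp p (tImp q p)),
     ex3 (\<lambda>p q r. is_fm_fm p \<^bold>\<and> is_fm_fm q \<^bold>\<and> is_fm_fm r \<^bold>\<and>
       up 3 z \<^bold>= tImp (tImp p (tImp q r)) (tImp (tImp p q) (tImp p r))),
     ex1 (\<lambda>p. is_fm_fm p \<^bold>\<and> up 1 z \<^bold>= tImp (tImp (tImp p tFalsity) tFalsity) p),
     ex3 (\<lambda>p t q. is_fm_fm p \<^bold>\<and> is_trm_fm t \<^bold>\<and> subst_graph Zero t p q \<^bold>\<and>
       up 3 z \<^bold>= tImp (tForall p) q),
     ex3 (\<lambda>p q p'. is_fm_fm p \<^bold>\<and> is_fm_fm q \<^bold>\<and> lift_graph Zero p p' \<^bold>\<and>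
       up 3 z \<^bold>= tImp (tForall (tImp p' q)) (tImp p (tForall q))),
     disj (map (\<lambda>p. z \<^bold>= \<lceil>p\<rceil>) basic_axioms),
     ex4 (\<lambda>p p0 p1 p2. is_fm_fm p \<^bold>\<and> subst_graph Zero (quote_trm Zero) p p0 \<^bold>\<and>
       lift_graph (num_trm 1) p p1 \<^bold>\<and> subst_graph Zero (quote_trm (Succ (Var 0))) p1 p2 \<^bold>\<and>
       up 4 z \<^bold>= tImp p0 (tImp (tForall (tImp p p2)) (tForall p)))]"

definition proof_step :: "trm \<Rightarrow> trm \<Rightarrow> trm \<Rightarrow> trm \<Rightarrow> fm" where
  "proof_step a b i z = disj
    [axiom_fm z,
     ex1 (\<lambda>p. before (up 1 a) (up 1 b) (up 1 i) (tImp p (up 1 z)) \<^bold>\<and>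
       before (up 1 a) (up 1 b) (up 1 i) p),
     ex1 (\<lambda>p. before (up 1 a) (up 1 b) (up 1 i) p \<^bold>\<and> up 1 z \<^bold>= tForall p)]"

text \<open>The proof predicate: \<open>x\<close> is the code \<open>\<langle>\<langle>a, b\<rangle>, n\<rangle>\<close> of a sequence of \<open>n + 1\<close> codes of
  formulas which is a proof, and its last entry is \<open>y\<close>.\<close>

definition Prf :: "trm \<Rightarrow> trm \<Rightarrow> fm" where
  "Prf x y = ex3 (\<lambda>a b n. up 3 x \<^bold>= \<langle>\<langle>a, b\<rangle>, n\<rangle> \<^bold>\<and> beta_fm a b n (up 3 y) \<^bold>\<and>
     constr_seq proof_step a b n)"

definition Prov :: "trm \<Rightarrow> fm" where
  "Prov y = ex1 (\<lambda>x. Prf x (up 1 y))"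


section \<open>Extreme independence\<close>

text \<open>\<open>Box p\<close>, where \<open>p\<close> may contain the free variable \<open>x\<close> (index 0), is the formula saying
  of \<open>x\<close> that the result of substituting the numeral of \<open>x\<close> for the variable in \<open>p\<close> is provable.\<close>

definition Box :: "fm \<Rightarrow> fm" where
  "Box p = ex2 (\<lambda>s y. num_graph (Var 2) s \<^bold>\<and> subst_graph Zero s \<lceil>p\<rceil> y \<^bold>\<and> Prov y)"

definition cf :: "nat \<Rightarrow> fm \<Rightarrow> fm" where
  "cf n A = Forall ((Box ^^ n) (Neg (Prf (Var 0) \<lceil>A\<rceil>)))"

definition constructively_true :: "fm \<Rightarrow> bool" where
  "constructively_true A \<longleftrightarrow> PA \<turnstile> A"

definition constructively_false :: "nat \<Rightarrow> fm \<Rightarrow> bool" where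
  "constructively_false n A \<longleftrightarrow> PA \<turnstile> cf n A"

definition strongly_independent :: "fm \<Rightarrow> bool" where
  "strongly_independent A \<longleftrightarrow>
     \<not> constructively_true A \<and> (\<forall>n\<ge>1. \<not> constructively_false n A)"

definition extremely_independent :: "fm \<Rightarrow> bool" where
  "extremely_independent A \<longleftrightarrow> strongly_independent A \<and> strongly_independent (Neg A)"


section \<open>The standard model\<close>

text \<open>The facts from here on show that PA is sound and that \<open>Prf\<close>, \<open>Prov\<close> and \<open>Box\<close> have the
  intended meaning in the standard model (theorems \<open>PA_sound\<close>, \<open>sat_Prf\<close>, \<open>sat_Prov\<close>, \<open>sat_Box\<close>,
  \<open>sat_cf\<close> below).\<close>

primrec val :: "(nat \<Rightarrow> nat) \<Rightarrow> trm \<Rightarrow> nat" where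
  "val e Zero = 0"
| "val e (Var n) = e n"
| "val e (Succ t) = Suc (val e t)"
| "val e (Add s t) = val e s + val e t"
| "val e (Mul s t) = val e s * val e t"

primrec sat :: "(nat \<Rightarrow> nat) \<Rightarrow> fm \<Rightarrow> bool" where
  "sat e (s \<^bold>= t) \<longleftrightarrow> val e s = val e t"
| "sat e Falsity \<longleftrightarrow> False"
| "sat e (p \<^bold>\<longrightarrow> q) \<longleftrightarrow> (sat e p \<longrightarrow> sat e q)"
| "sat e (Forall p) \<longleftrightarrow> (\<forall>x. sat (case_nat x e) p)"

lemma sat_connectives [simp]:
  "sat e (Neg p) \<longleftrightarrow> \<not> sat e p"
  "sat e (p \<^bold>\<and> q) \<longleftrightarrow> sat e p \<and> sat e q"
  "sat e (p \<^bold>\<or> q) \<longleftrightarrow> sat e p \<or> sat e q"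
  "sat e (Ex p) \<longleftrightarrow> (\<exists>x. sat (case_nat x e) p)"
  by (auto simp: Neg_def And_def Or_def Ex_def)

definition ins :: "nat \<Rightarrow> nat \<Rightarrow> (nat \<Rightarrow> nat) \<Rightarrow> nat \<Rightarrow> nat" where
  "ins k x e n = (if n < k then e n else if n = k then x else e (n - 1))"

lemma case_nat_ins: "case_nat y (ins k x e) = ins (Suc k) x (case_nat y e)"
  by (auto simp: ins_def fun_eq_iff split: nat.split)

lemma ins_0: "ins 0 x e = case_nat x e"
  by (auto simp: ins_def fun_eq_iff split: nat.split)

lemma val_lift: "val (ins k x e) (lift_trm k t) = val e t"
  by (induction t) (auto simp: ins_def)

lemma sat_lift: "sat (ins k x e) (lift_fm k p) \<longleftrightarrow> sat e p"
  by (induction p arbitrary: k e) (simp_all add: val_lift case_nat_ins)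

lemma val_lift_0 [simp]: "val (case_nat x e) (lift_trm 0 t) = val e t"
  using val_lift[of 0] by (simp add: ins_0)

lemma val_subst: "val e (subst_trm k s t) = val (ins k (val e s) e) t"
  by (induction t) (auto simp: ins_def)

lemma sat_subst: "sat e (subst_fm k s p) \<longleftrightarrow> sat (ins k (val e s) e) p"
  by (induction p arbitrary: k s e) (simp_all add: val_subst case_nat_ins)

lemma val_num [simp]: "val e (num_trm n) = n"
  by (induction n) auto

lemma PA_axiom_sound: "PA_axiom p \<Longrightarrow> sat e p"
proof (induction rule: PA_axiom.induct)
  case (Dist p q)
  show ?case by (auto simp: sat_lift[of 0, unfolded ins_0])
next
  case (Basic p)
  then show ?case by (auto simp: basic_axioms_def)
next
  case (Ind p)
  have *: "sat (case_nat x e) (subst_fm 0 (Succ (Var 0)) (lift_fm 1 p)) \<longleftrightarrow> sat (case_nat (Suc x) e) p" for x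
  proof -
    have "ins 0 (Suc x) (case_nat x e) = ins 1 x (case_nat (Suc x) e)"
      by (auto simp: ins_def fun_eq_iff split: nat.split)
    then show ?thesis
      by (simp add: sat_subst sat_lift)
  qed
  show ?case
    unfolding sat.simps *
  proof (intro impI allI)
    fix x assume "sat e (subst_fm 0 Zero p)"
      and step: "\<forall>x. sat (case_nat x e) p \<longrightarrow> sat (case_nat (Suc x) e) p"
    then show "sat (case_nat x e) p"
      by (induction x) (auto simp: sat_subst ins_0)
  qed
qed (auto simp: sat_subst ins_0)

theorem PA_sound: "PA \<turnstile> p \<Longrightarrow> sat e p"
  by (induction arbitrary: e rule: PA_proves.induct) (auto simp: PA_axiom_sound)


section \<open>Adequacy of the Goedel numbering\<close>

lemma pair_eq [simp]: "pair x y = pair x' y' \<longleftrightarrow> x = x' \<and> y = y'"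
proof
  assume eq: "pair x y = pair x' y'"
  have less: "pair x y < pair x' y'" if "x + y < x' + y'" for x y x' y'
  proof -
    have "(x + y) * (x + y) + x < Suc (x + y) * Suc (x + y)" by simp
    also have "\<dots> \<le> (x' + y') * (x' + y')" using that by (intro mult_le_mono) auto
    finally show ?thesis by (simp add: pair_def)
  qed
  have "x + y = x' + y'"
    using less[of x y x' y'] less[of x' y' x y] eq by linarith
  then show "x = x' \<and> y = y'" using eq by (simp add: pair_def)
qed auto

lemma code_trm_eq [simp]: "code_trm s = code_trm t \<longleftrightarrow> s = t"
proof (induction s arbitrary: t)
  case Zero show ?case by (cases t) auto
next
  case Var show ?case by (cases t) auto
next
  case Succ then show ?case by (cases t) auto
next
  case Add then show ?case by (cases t) auto
next
  case Mul then show ?case by (cases t) auto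
qed

lemma code_fm_eq [simp]: "code_fm p = code_fm q \<longleftrightarrow> p = q"
proof (induction p arbitrary: q)
  case Eq show ?case by (cases q) auto
next
  case Falsity show ?case by (cases q) auto
next
  case Imp then show ?case by (cases q) auto
next
  case Forall then show ?case by (cases q) auto
qed

lemma code_trm_neq_code_fm [simp]: "code_trm t \<noteq> code_fm p" "code_fm p \<noteq> code_trm t"
  by (cases t; cases p; simp)+

definition beta :: "nat \<Rightarrow> nat \<Rightarrow> nat \<Rightarrow> nat" where
  "beta a b i = a mod Suc (Suc i * b)"

lemma beta_surj: "\<exists>a b. \<forall>i<length xs. beta a b i = xs ! i"
proof -
  define M where "M = Suc (length xs + sum_list xs)"
  define b where "b = (fact M :: nat)"
  define m where "m i = Suc (Suc i * b)" for i
  have "M \<le> b" unfolding b_def by (rule fact_ge_self)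
  have co: "coprime (m i) (m j)" if "i < j" "j < length xs" for i j
  proof (rule ccontr)
    assume "\<not> coprime (m i) (m j)"
    then have "gcd (m i) (m j) \<noteq> 1" by (simp add: coprime_iff_gcd_eq_1)
    then obtain p where "prime p" "p dvd gcd (m i) (m j)" using prime_factor_nat by blast
    then have p: "prime p" "p dvd m i" "p dvd m j" by auto
    then have "p dvd m j - m i" by (simp add: dvd_diff_nat)
    also have "m j - m i = (j - i) * b" by (simp add: m_def diff_mult_distrib)
    finally have "p dvd j - i \<or> p dvd b" using p prime_dvd_mult_nat by blast
    moreover have "j - i dvd b" unfolding b_def using that by (intro dvd_fact) (auto simp: M_def)
    ultimately have "p dvd b" by (meson dvd_trans)
    then have "p dvd m i - Suc i * b" using p by (intro dvd_diff_nat) auto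
    then show False using p by (simp add: m_def)
  qed
  have co': "\<forall>i\<in>{..<length xs}. \<forall>j\<in>{..<length xs}. i \<noteq> j \<longrightarrow> coprime (m i) (m j)"
    by (metis co coprime_commute lessThan_iff linorder_neqE_nat)
  obtain a where a: "\<forall>i\<in>{..<length xs}. [a = xs ! i] (mod m i)"
    using chinese_remainder_nat[OF _ co', of "\<lambda>i. xs ! i"] by auto
  have "beta a b i = xs ! i" if "i < length xs" for i
  proof -
    have "xs ! i \<le> sum_list xs" using that by (simp add: member_le_sum_list)
    then have "xs ! i < m i" using \<open>M \<le> b\<close> by (simp add: m_def M_def)
    moreover have "a mod m i = xs ! i mod m i" using a that by (simp add: cong_def)
    ultimately show ?thesis by (simp add: beta_def m_def)
  qed
  then show ?thesis by blast
qed

lemma val_up [simp]: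
  "val (case_nat x1 e) (up (Suc 0) t) = val e t"
  "val (case_nat x2 (case_nat x1 e)) (up 2 t) = val e t"
  "val (case_nat x3 (case_nat x2 (case_nat x1 e))) (up 3 t) = val e t"
  "val (case_nat x4 (case_nat x3 (case_nat x2 (case_nat x1 e)))) (up 4 t) = val e t"
  "val (case_nat x5 (case_nat x4 (case_nat x3 (case_nat x2 (case_nat x1 e))))) (up 5 t) = val e t"
  "val (case_nat x6 (case_nat x5 (case_nat x4 (case_nat x3 (case_nat x2 (case_nat x1 e)))))) (up 6 t) = val e t"
  by (simp_all add: up_def numeral_eq_Suc)

lemma val_code [simp]:
  "val e \<langle>s, t\<rangle> = pair (val e s) (val e t)"
  "val e \<lceil>p\<rceil> = code_fm p"
  "val e (quote_trm t) = code_trm t"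
  by (simp_all add: tpair_def pair_def quote_fm_def quote_trm_def)

lemma val_constructors [simp]:
  "val e tZero = pair 1 0"
  "val e (tVar s) = pair 2 (val e s)"
  "val e (tSucc s) = pair 3 (val e s)"
  "val e (tAdd s t) = pair 4 (pair (val e s) (val e t))"
  "val e (tMul s t) = pair 5 (pair (val e s) (val e t))"
  "val e (tEq s t) = pair 6 (pair (val e s) (val e t))"
  "val e tFalsity = pair 7 0"
  "val e (tImp s t) = pair 8 (pair (val e s) (val e t))"
  "val e (tForall s) = pair 9 (val e s)"
  unfolding tZero_def tVar_def tSucc_def tAdd_def tMul_def tEq_def tFalsity_def tImp_def tForall_def
  by (simp_all only: val_code val_num)

lemma sat_disj [simp]: "sat e (disj ps) \<longleftrightarrow> (\<exists>p\<in>set ps. sat e p)"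
  by (induction ps) (auto simp: disj_def)

lemmas ex_defs = ex1_def ex2_def ex3_def ex4_def ex5_def ex6_def

lemma sat_leq [simp]: "sat e (s \<^bold>\<le> t) \<longleftrightarrow> val e s \<le> val e t"
  by (auto simp: leq_fm_def ex_defs le_iff_add)

lemma sat_less [simp]: "sat e (s \<^bold>< t) \<longleftrightarrow> val e s < val e t"
  by (auto simp: less_fm_def)

lemma sat_all_leq [simp]: "sat e (all_leq n f) \<longleftrightarrow> (\<forall>x \<le> val e n. sat (case_nat x e) (f (Var 0)))"
  by (simp add: all_leq_def)

lemma sat_beta [simp]:
  "sat e (beta_fm a b i z) \<longleftrightarrow> val e z = beta (val e a) (val e b) (val e i)"
proof -
  have "z \<le> m \<and> (\<exists>q. a = q * Suc m + z) \<longleftrightarrow> z = a mod Suc m" for z m a :: nat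
  proof
    assume "z \<le> m \<and> (\<exists>q. a = q * Suc m + z)"
    then obtain q where "z < Suc m" "a = z + q * Suc m" by auto
    then show "z = a mod Suc m" by (simp only: mod_mult_self1 mod_less)
  next
    assume z: "z = a mod Suc m"
    then have "a = (a div Suc m) * Suc m + z" by (simp only: div_mult_mod_eq)
    then show "z \<le> m \<and> (\<exists>q. a = q * Suc m + z)" using z
      by (metis less_Suc_eq_le mod_less_divisor zero_less_Suc)
  qed
  from this[of "val e z" "Suc (val e i) * val e b" "val e a"] show ?thesis
    by (simp add: beta_fm_def ex_defs beta_def del: mult_Suc mult_Suc_right)
qed

lemma sat_before [simp]:
  "sat e (before a b i u) \<longleftrightarrow> (\<exists>j < val e i. val e u = beta (val e a) (val e b) j)"
  by (auto simp: before_def ex_defs)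

text \<open>\<open>der S\<close>: the values obtained by finitely many construction steps \<open>S\<close>.\<close>

inductive der :: "((nat \<Rightarrow> bool) \<Rightarrow> nat \<Rightarrow> bool) \<Rightarrow> nat \<Rightarrow> bool" for S where
  "\<forall>u\<in>set us. der S u \<Longrightarrow> S (\<lambda>u. u \<in> set us) x \<Longrightarrow> der S x"

definition justified :: "((nat \<Rightarrow> bool) \<Rightarrow> nat \<Rightarrow> bool) \<Rightarrow> nat list \<Rightarrow> bool" where
  "justified S xs \<longleftrightarrow> (\<forall>i<length xs. S (\<lambda>u. u \<in> set (take i xs)) (xs ! i))"

definition monoS :: "((nat \<Rightarrow> bool) \<Rightarrow> nat \<Rightarrow> bool) \<Rightarrow> bool" where
  "monoS S \<longleftrightarrow> (\<forall>P Q z. (\<forall>u. P u \<longrightarrow> Q u) \<longrightarrow> S P z \<longrightarrow> S Q z)"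

lemma monoSD: "monoS S \<Longrightarrow> S P z \<Longrightarrow> (\<And>u. P u \<Longrightarrow> Q u) \<Longrightarrow> S Q z"
  unfolding monoS_def by blast

lemma justified_append:
  assumes "monoS S" "justified S xs" "justified S ys"
  shows "justified S (xs @ ys)"
  unfolding justified_def
proof (intro allI impI)
  fix i assume i: "i < length (xs @ ys)"
  show "S (\<lambda>u. u \<in> set (take i (xs @ ys))) ((xs @ ys) ! i)"
  proof (cases "i < length xs")
    case True
    then show ?thesis using assms(2) by (simp add: justified_def nth_append)
  next
    case False
    then have "S (\<lambda>u. u \<in> set (take (i - length xs) ys)) (ys ! (i - length xs))"
      using assms(3) i by (simp add: justified_def)
    from monoSD[OF assms(1) this] False show ?thesis by (simp add: nth_append)
  qed
qed

lemma der_justified: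
  assumes "monoS S" "der S x"
  shows "\<exists>xs. justified S xs \<and> x \<in> set xs"
  using assms(2)
proof induction
  case (1 us x)
  have "set vs \<subseteq> set us \<Longrightarrow> \<exists>xs. justified S xs \<and> set vs \<subseteq> set xs" for vs
  proof (induction vs)
    case Nil
    have "justified S []" by (simp add: justified_def)
    then show ?case by auto
  next
    case (Cons v vs)
    then obtain xs where xs: "justified S xs" "set vs \<subseteq> set xs" by auto
    obtain ys where ys: "justified S ys" "v \<in> set ys" using 1(1) Cons by auto
    show ?case using justified_append[OF assms(1) xs(1) ys(1)] xs ys
      by (intro exI[of _ "xs @ ys"]) auto
  qed
  from this[of us] obtain xs where xs: "justified S xs" "set us \<subseteq> set xs" by auto
  have "S (\<lambda>u. u \<in> set xs) x" using monoSD[OF assms(1) 1(2), of "\<lambda>u. u \<in> set xs"] xs(2) by auto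
  then have "justified S (xs @ [x])"
    using xs(1) by (auto simp: justified_def nth_append less_Suc_eq)
  then show ?case by (intro exI[of _ "xs @ [x]"]) auto
qed

definition constr_at :: "((nat \<Rightarrow> bool) \<Rightarrow> nat \<Rightarrow> bool) \<Rightarrow> nat \<Rightarrow> nat \<Rightarrow> nat \<Rightarrow> bool" where
  "constr_at S a b n \<longleftrightarrow> (\<forall>i\<le>n. S (\<lambda>u. \<exists>j<i. u = beta a b j) (beta a b i))"

lemma constr_at_sound:
  assumes "monoS S" "constr_at S a b n" "\<And>z. S R z \<Longrightarrow> R z" "i \<le> n"
  shows "R (beta a b i)"
  using assms(4)
proof (induction i rule: less_induct)
  case (less i)
  have "S (\<lambda>u. \<exists>j<i. u = beta a b j) (beta a b i)" using assms(2) less by (simp add: constr_at_def)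
  from monoSD[OF assms(1) this, of R] less show ?case
    by (intro assms(3)) auto
qed

lemma constr_at_complete:
  assumes "monoS S" "der S x"
  shows "\<exists>a b n. x = beta a b n \<and> constr_at S a b n"
proof -
  obtain xs where xs: "justified S xs" "x \<in> set xs" using der_justified[OF assms] by auto
  then obtain n where n: "n < length xs" "x = xs ! n" by (metis in_set_conv_nth)
  obtain a b where ab: "\<forall>i<length xs. beta a b i = xs ! i" using beta_surj by blast
  have "S (\<lambda>u. \<exists>j<i. u = beta a b j) (beta a b i)" if "i \<le> n" for i
  proof -
    have "S (\<lambda>u. u \<in> set (take i xs)) (xs ! i)" using xs(1) that n by (simp add: justified_def)
    moreover have "u \<in> set (take i xs) \<Longrightarrow> \<exists>j<i. u = beta a b j" for u
      using ab that n by (auto simp: in_set_conv_nth)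
    ultimately have "S (\<lambda>u. \<exists>j<i. u = beta a b j) (xs ! i)" by (rule monoSD[OF assms(1)])
    then show ?thesis using ab that n by simp
  qed
  then have "constr_at S a b n" by (simp add: constr_at_def)
  moreover have "x = beta a b n" using ab n by simp
  ultimately show ?thesis by blast
qed

definition represents :: "(trm \<Rightarrow> trm \<Rightarrow> trm \<Rightarrow> trm \<Rightarrow> fm) \<Rightarrow> ((nat \<Rightarrow> bool) \<Rightarrow> nat \<Rightarrow> bool) \<Rightarrow> bool" where
  "represents step S \<longleftrightarrow> monoS S \<and> (\<forall>e a b i z. sat e (step a b i z) \<longleftrightarrow>
     S (\<lambda>u. \<exists>j < val e i. u = beta (val e a) (val e b) j) (val e z))"

lemma sat_constr_seq:
  "represents step S \<Longrightarrow> sat e (constr_seq step a b n) \<longleftrightarrow> constr_at S (val e a) (val e b) (val e n)"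
  by (simp add: represents_def constr_seq_def ex_defs constr_at_def)

lemma sat_constructible_iff:
  "represents step S \<Longrightarrow> sat e (constructible step x) \<longleftrightarrow>
     (\<exists>a b n. val e x = beta a b n \<and> constr_at S a b n)"
  by (simp add: constructible_def ex_defs sat_constr_seq)

lemma constructible_sound:
  assumes "represents step S" "\<And>z. S R z \<Longrightarrow> R z" "sat e (constructible step x)"
  shows "R (val e x)"
proof -
  obtain a b n where "val e x = beta a b n" "constr_at S a b n"
    using assms(1,3) by (auto simp: sat_constructible_iff)
  moreover have "monoS S" using assms(1) by (simp add: represents_def)
  ultimately show ?thesis using assms(2) constr_at_sound[where S=S and R=R and a=a and b=b and n=n and i=n] by simp
qed

lemma constructible_complete:
  assumes "represents step S" "der S (val e x)"
  shows "sat e (constructible step x)"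
proof -
  have "monoS S" using assms(1) by (simp add: represents_def)
  then show ?thesis using constr_at_complete[OF _ assms(2)] sat_constructible_iff[OF assms(1)] by simp
qed

definition S_trm :: "(nat \<Rightarrow> bool) \<Rightarrow> nat \<Rightarrow> bool" where
  "S_trm P z \<longleftrightarrow> z = pair 1 0 \<or> (\<exists>n. z = pair 2 n) \<or> (\<exists>t. P t \<and> z = pair 3 t) \<or>
     (\<exists>s t. P s \<and> P t \<and> (z = pair 4 (pair s t) \<or> z = pair 5 (pair s t)))"

lemma represents_trm: "represents is_trm_step S_trm"
  unfolding represents_def
proof (intro conjI allI)
  show "monoS S_trm" unfolding monoS_def S_trm_def by blast
qed (simp add: is_trm_step_def ex_defs S_trm_def)

lemma der_trm: "der S_trm (code_trm t)"
proof (induction t)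
  case Zero show ?case by (rule der.intros[of "[]"]) (auto simp: S_trm_def)
next
  case (Var n) show ?case by (rule der.intros[of "[]"]) (auto simp: S_trm_def)
next
  case (Succ t) then show ?case by (intro der.intros[of "[code_trm t]"]) (auto simp: S_trm_def)
next
  case (Add s t) then show ?case
    by (intro der.intros[of "[code_trm s, code_trm t]"]) (auto simp: S_trm_def)
next
  case (Mul s t) then show ?case
    by (intro der.intros[of "[code_trm s, code_trm t]"]) (auto simp: S_trm_def)
qed

lemma sat_is_trm [simp]: "sat e (is_trm_fm x) \<longleftrightarrow> (\<exists>t. val e x = code_trm t)"
proof
  assume "sat e (is_trm_fm x)"
  then show "\<exists>t. val e x = code_trm t"
  proof (intro constructible_sound[OF represents_trm, of "\<lambda>z. \<exists>t. z = code_trm t"])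
    fix z assume "S_trm (\<lambda>z. \<exists>t. z = code_trm t) z"
    then show "\<exists>t. z = code_trm t"
      unfolding S_trm_def by (metis code_trm.simps)
  qed (simp add: is_trm_fm_def)
next
  assume "\<exists>t. val e x = code_trm t"
  then show "sat e (is_trm_fm x)"
    unfolding is_trm_fm_def by (metis constructible_complete der_trm represents_trm)
qed

definition S_fm :: "(nat \<Rightarrow> bool) \<Rightarrow> nat \<Rightarrow> bool" where
  "S_fm P z \<longleftrightarrow> (\<exists>s t. z = code_fm (s \<^bold>= t)) \<or> z = pair 7 0 \<or>
     (\<exists>p q. P p \<and> P q \<and> z = pair 8 (pair p q)) \<or> (\<exists>p. P p \<and> z = pair 9 p)"

lemma represents_fm: "represents is_fm_step S_fm"
  unfolding represents_def
proof (intro conjI allI)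
  show "monoS S_fm" unfolding monoS_def S_fm_def by blast
qed (force simp: is_fm_step_def ex_defs S_fm_def)

lemma der_fm: "der S_fm (code_fm p)"
proof (induction p)
  case Eq show ?case by (rule der.intros[of "[]"]) (force simp: S_fm_def)+
next
  case Falsity show ?case by (rule der.intros[of "[]"]) (auto simp: S_fm_def)
next
  case (Imp p q) then show ?case
    by (intro der.intros[of "[code_fm p, code_fm q]"]) (auto simp: S_fm_def)
next
  case (Forall p) then show ?case by (intro der.intros[of "[code_fm p]"]) (auto simp: S_fm_def)
qed

lemma sat_is_fm [simp]: "sat e (is_fm_fm x) \<longleftrightarrow> (\<exists>p. val e x = code_fm p)"
proof
  assume "sat e (is_fm_fm x)"
  then show "\<exists>p. val e x = code_fm p"
  proof (intro constructible_sound[OF represents_fm, of "\<lambda>z. \<exists>p. z = code_fm p"])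
    fix z assume "S_fm (\<lambda>z. \<exists>p. z = code_fm p) z"
    then show "\<exists>p. z = code_fm p"
      unfolding S_fm_def by (metis code_fm.simps)
  qed (simp add: is_fm_fm_def)
next
  assume "\<exists>p. val e x = code_fm p"
  then show "sat e (is_fm_fm x)"
    unfolding is_fm_fm_def by (metis constructible_complete der_fm represents_fm)
qed

definition S_lift :: "(nat \<Rightarrow> bool) \<Rightarrow> nat \<Rightarrow> bool" where
  "S_lift P z \<longleftrightarrow>
     (\<exists>k. z = pair k (pair (pair 1 0) (pair 1 0))) \<or>
     (\<exists>k n. n < k \<and> z = pair k (pair (pair 2 n) (pair 2 n))) \<or>
     (\<exists>k n. k \<le> n \<and> z = pair k (pair (pair 2 n) (pair 2 (Suc n)))) \<or>
     (\<exists>k x y. P (pair k (pair x y)) \<and> z = pair k (pair (pair 3 x) (pair 3 y))) \<or>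
     (\<exists>k x y x' y'. P (pair k (pair x y)) \<and> P (pair k (pair x' y')) \<and>
       (\<exists>c\<in>{4,5,6,8}. z = pair k (pair (pair c (pair x x')) (pair c (pair y y'))))) \<or>
     (\<exists>k. z = pair k (pair (pair 7 0) (pair 7 0))) \<or>
     (\<exists>k x y. P (pair (Suc k) (pair x y)) \<and> z = pair k (pair (pair 9 x) (pair 9 y)))"

lemma represents_lift: "represents lift_step S_lift"
  unfolding represents_def
proof (intro conjI allI)
  show "monoS S_lift"
    unfolding monoS_def S_lift_def
    by (intro allI impI, elim disj_forward ex_forward conj_forward; blast)
qed (simp add: lift_step_def ex_defs S_lift_def)

lemma der_lift_trm: "der S_lift (pair k (pair (code_trm t) (code_trm (lift_trm k t))))"
proof (induction t)
  case Zero show ?case by (rule der.intros[of "[]"]) (auto simp: S_lift_def)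
next
  case (Var n) show ?case by (rule der.intros[of "[]"]) (auto simp: S_lift_def)
next
  case (Succ t) then show ?case
    by (intro der.intros[of "[pair k (pair (code_trm t) (code_trm (lift_trm k t)))]"]) (auto simp: S_lift_def)
next
  case (Add s t) then show ?case
    by (intro der.intros[of "[pair k (pair (code_trm s) (code_trm (lift_trm k s))),
      pair k (pair (code_trm t) (code_trm (lift_trm k t)))]"]) (auto simp: S_lift_def)
next
  case (Mul s t) then show ?case
    by (intro der.intros[of "[pair k (pair (code_trm s) (code_trm (lift_trm k s))),
      pair k (pair (code_trm t) (code_trm (lift_trm k t)))]"]) (auto simp: S_lift_def)
qed

lemma der_lift_fm: "der S_lift (pair k (pair (code_fm p) (code_fm (lift_fm k p))))"
proof (induction p arbitrary: k)
  case (Eq s t) show ?case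
    by (rule der.intros[of "[pair k (pair (code_trm s) (code_trm (lift_trm k s))),
      pair k (pair (code_trm t) (code_trm (lift_trm k t)))]"], simp add: der_lift_trm)
      (auto simp: S_lift_def)
next
  case Falsity show ?case by (rule der.intros[of "[]"]) (auto simp: S_lift_def)
next
  case (Imp p q) then show ?case
    by (intro der.intros[of "[pair k (pair (code_fm p) (code_fm (lift_fm k p))),
      pair k (pair (code_fm q) (code_fm (lift_fm k q)))]"]) (auto simp: S_lift_def)
next
  case (Forall p) then show ?case
    by (intro der.intros[of "[pair (Suc k) (pair (code_fm p) (code_fm (lift_fm (Suc k) p)))]"])
      (auto simp: S_lift_def)
qed

definition lift_rel :: "nat \<Rightarrow> nat \<Rightarrow> nat \<Rightarrow> bool" where
  "lift_rel k x y \<longleftrightarrow> (\<forall>t. x = code_trm t \<longrightarrow> y = code_trm (lift_trm k t)) \<and>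
     (\<forall>p. x = code_fm p \<longrightarrow> y = code_fm (lift_fm k p))"

lemma code_trm_inv:
  "pair 1 0 = code_trm t \<longleftrightarrow> t = Zero"
  "pair (Suc 0) 0 = code_trm t \<longleftrightarrow> t = Zero"
  "pair 2 n = code_trm t \<longleftrightarrow> t = Var n"
  "pair 3 x = code_trm t \<longleftrightarrow> (\<exists>t'. t = Succ t' \<and> x = code_trm t')"
  "pair 4 x = code_trm t \<longleftrightarrow> (\<exists>t1 t2. t = Add t1 t2 \<and> x = pair (code_trm t1) (code_trm t2))"
  "pair 5 x = code_trm t \<longleftrightarrow> (\<exists>t1 t2. t = Mul t1 t2 \<and> x = pair (code_trm t1) (code_trm t2))"
  "pair 6 x \<noteq> code_trm t" "pair 7 x \<noteq> code_trm t" "pair 8 x \<noteq> code_trm t" "pair 9 x \<noteq> code_trm t"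
  by (cases t; auto)+

lemma code_fm_inv:
  "pair 1 x \<noteq> code_fm p" "pair (Suc 0) x \<noteq> code_fm p" "pair 2 x \<noteq> code_fm p" "pair 3 x \<noteq> code_fm p"
  "pair 4 x \<noteq> code_fm p" "pair 5 x \<noteq> code_fm p"
  "pair 6 x = code_fm p \<longleftrightarrow> (\<exists>t1 t2. p = (t1 \<^bold>= t2) \<and> x = pair (code_trm t1) (code_trm t2))"
  "pair 7 x = code_fm p \<longleftrightarrow> x = 0 \<and> p = Falsity"
  "pair 8 x = code_fm p \<longleftrightarrow> (\<exists>p1 p2. p = (p1 \<^bold>\<longrightarrow> p2) \<and> x = pair (code_fm p1) (code_fm p2))"
  "pair 9 x = code_fm p \<longleftrightarrow> (\<exists>p'. p = Forall p' \<and> x = code_fm p')"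
  by (cases p; auto)+

lemma lift_graph_rel:
  assumes "sat e (lift_graph k x y)"
  shows "lift_rel (val e k) (val e x) (val e y)"
proof -
  define R where "R z \<longleftrightarrow> (\<forall>k x y. z = pair k (pair x y) \<longrightarrow> lift_rel k x y)" for z
  have "R (val e \<langle>k, \<langle>x, y\<rangle>\<rangle>)"
  proof (rule constructible_sound[OF represents_lift])
    fix z assume "S_lift R z"
    then show "R z"
      unfolding S_lift_def R_def
      by (elim disjE exE conjE bexE)
        (simp_all, auto simp: lift_rel_def code_trm_inv code_fm_inv)
  qed (use assms in \<open>simp add: lift_graph_def\<close>)
  then show ?thesis by (simp add: R_def)
qed

lemma sat_lift_graph_trm:
  "val e x = code_trm t \<Longrightarrow> sat e (lift_graph k x y) \<longleftrightarrow> val e y = code_trm (lift_trm (val e k) t)"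
  using lift_graph_rel[of e k x y] der_lift_trm[of "val e k" t]
  by (auto simp: lift_rel_def lift_graph_def intro!: constructible_complete[OF represents_lift])

lemma sat_lift_graph_fm:
  "val e x = code_fm p \<Longrightarrow> sat e (lift_graph k x y) \<longleftrightarrow> val e y = code_fm (lift_fm (val e k) p)"
  using lift_graph_rel[of e k x y] der_lift_fm[of "val e k" p]
  by (auto simp: lift_rel_def lift_graph_def intro!: constructible_complete[OF represents_lift])


definition S_subst :: "(nat \<Rightarrow> bool) \<Rightarrow> nat \<Rightarrow> bool" where
  "S_subst P z \<longleftrightarrow>
     (\<exists>k s. z = pair k (pair s (pair (pair 1 0) (pair 1 0)))) \<or>
     (\<exists>k s n. n < k \<and> z = pair k (pair s (pair (pair 2 n) (pair 2 n)))) \<or>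
     (\<exists>k s. z = pair k (pair s (pair (pair 2 k) s))) \<or>
     (\<exists>k s n. k \<le> n \<and> z = pair k (pair s (pair (pair 2 (Suc n)) (pair 2 n)))) \<or>
     (\<exists>k s x y. P (pair k (pair s (pair x y))) \<and> z = pair k (pair s (pair (pair 3 x) (pair 3 y)))) \<or>
     (\<exists>k s x y x' y'. P (pair k (pair s (pair x y))) \<and> P (pair k (pair s (pair x' y'))) \<and>
       (\<exists>c\<in>{4,5,6,8}. z = pair k (pair s (pair (pair c (pair x x')) (pair c (pair y y')))))) \<or>
     (\<exists>k s. z = pair k (pair s (pair (pair 7 0) (pair 7 0)))) \<or>
     (\<exists>k s s' x y. sat (\<lambda>_. 0) (lift_graph Zero (num_trm s) (num_trm s')) \<and>
       P (pair (Suc k) (pair s' (pair x y))) \<and> z = pair k (pair s (pair (pair 9 x) (pair 9 y))))"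

lemma sat_lift_graph_cong:
  "val e k = val e' k' \<Longrightarrow> val e x = val e' x' \<Longrightarrow> val e y = val e' y' \<Longrightarrow>
     sat e (lift_graph k x y) \<longleftrightarrow> sat e' (lift_graph k' x' y')"
  by (simp add: lift_graph_def sat_constructible_iff[OF represents_lift])

lemma represents_subst: "represents subst_step S_subst"
  unfolding represents_def
proof (intro conjI allI)
  show "monoS S_subst"
    unfolding monoS_def S_subst_def
    by (intro allI impI, elim disj_forward ex_forward conj_forward; blast)
next
  fix e a b i z
  have "sat (case_nat y (case_nat x (case_nat s' (case_nat s (case_nat k e))))) (lift_graph Zero (Var 3) (Var 2))
    \<longleftrightarrow> sat (\<lambda>_. 0) (lift_graph Zero (num_trm s) (num_trm s'))" for y x s s' k
    by (rule sat_lift_graph_cong) simp_all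
  then show "sat e (subst_step a b i z) \<longleftrightarrow>
     S_subst (\<lambda>u. \<exists>j < val e i. u = beta (val e a) (val e b) j) (val e z)"
    by (simp add: subst_step_def ex_defs S_subst_def)
qed

abbreviation (input) "subst_trip_trm k s t \<equiv>
  pair k (pair (code_trm s) (pair (code_trm t) (code_trm (subst_trm k s t))))"
abbreviation (input) "subst_trip_fm k s p \<equiv>
  pair k (pair (code_trm s) (pair (code_fm p) (code_fm (subst_fm k s p))))"

lemma der_subst_trm: "der S_subst (subst_trip_trm k s t)"
proof (induction t)
  case Zero show ?case by (rule der.intros[of "[]"]) (auto simp: S_subst_def)
next
  case (Var n)
  show ?case
  proof (rule der.intros[of "[]"])
    show "S_subst (\<lambda>u. u \<in> set []) (subst_trip_trm k s (Var n))"
      unfolding S_subst_def by (cases n) (auto simp: not_less le_less_Suc_eq)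
  qed auto
next
  case (Succ t) show ?case
    by (rule der.intros[of "[subst_trip_trm k s t]"], simp add: Succ) (auto simp: S_subst_def)
next
  case (Add t u) show ?case
    by (rule der.intros[of "[subst_trip_trm k s t, subst_trip_trm k s u]"], simp add: Add)
      (auto simp: S_subst_def)
next
  case (Mul t u) show ?case
    by (rule der.intros[of "[subst_trip_trm k s t, subst_trip_trm k s u]"], simp add: Mul)
      (auto simp: S_subst_def)
qed

lemma der_subst_fm: "der S_subst (subst_trip_fm k s p)"
proof (induction p arbitrary: k s)
  case (Eq t u) show ?case
    by (rule der.intros[of "[subst_trip_trm k s t, subst_trip_trm k s u]"], simp add: der_subst_trm)
      (auto simp: S_subst_def)
next
  case Falsity show ?case by (rule der.intros[of "[]"]) (auto simp: S_subst_def)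
next
  case (Imp p q) show ?case
    by (rule der.intros[of "[subst_trip_fm k s p, subst_trip_fm k s q]"], simp add: Imp)
      (auto simp: S_subst_def)
next
  case (Forall p)
  have "sat (\<lambda>_. 0) (lift_graph Zero (num_trm (code_trm s)) (num_trm (code_trm (lift_trm 0 s))))"
    by (subst sat_lift_graph_trm[of _ _ s]) simp_all
  then show ?case
    by (intro der.intros[of "[subst_trip_fm (Suc k) (lift_trm 0 s) p]"], simp add: Forall)
      (auto simp: S_subst_def)
qed

definition subst_rel :: "nat \<Rightarrow> nat \<Rightarrow> nat \<Rightarrow> nat \<Rightarrow> bool" where
  "subst_rel k c x y \<longleftrightarrow> (\<forall>s. c = code_trm s \<longrightarrow>
     (\<forall>t. x = code_trm t \<longrightarrow> y = code_trm (subst_trm k s t)) \<and>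
     (\<forall>p. x = code_fm p \<longrightarrow> y = code_fm (subst_fm k s p)))"

lemma subst_graph_rel:
  assumes "sat e (subst_graph k s x y)"
  shows "subst_rel (val e k) (val e s) (val e x) (val e y)"
proof -
  define R where "R z \<longleftrightarrow> (\<forall>k s x y. z = pair k (pair s (pair x y)) \<longrightarrow> subst_rel k s x y)" for z
  have "R (val e \<langle>k, \<langle>s, \<langle>x, y\<rangle>\<rangle>\<rangle>)"
  proof (rule constructible_sound[OF represents_subst])
    fix z assume "S_subst R z"
    then show "R z"
      unfolding S_subst_def R_def
      by (elim disjE exE conjE bexE)
        (simp_all, auto simp: subst_rel_def code_trm_inv code_fm_inv sat_lift_graph_trm)
  qed (use assms in \<open>simp add: subst_graph_def\<close>)
  then show ?thesis by (simp add: R_def)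
qed

lemma sat_subst_graph:
  assumes "val e s = code_trm s'" "val e x = code_fm p"
  shows "sat e (subst_graph k s x y) \<longleftrightarrow> val e y = code_fm (subst_fm (val e k) s' p)"
proof
  assume "sat e (subst_graph k s x y)"
  then show "val e y = code_fm (subst_fm (val e k) s' p)"
    using subst_graph_rel[of e k s x y] assms by (auto simp: subst_rel_def)
next
  assume "val e y = code_fm (subst_fm (val e k) s' p)"
  then show "sat e (subst_graph k s x y)"
    using der_subst_fm[of "val e k" s' p] assms unfolding subst_graph_def
    by (intro constructible_complete[OF represents_subst]) simp
qed

definition S_num :: "(nat \<Rightarrow> bool) \<Rightarrow> nat \<Rightarrow> bool" where
  "S_num P z \<longleftrightarrow> z = pair 0 (pair 1 0) \<or> (\<exists>n y. P (pair n y) \<and> z = pair (Suc n) (pair 3 y))"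

lemma represents_num: "represents num_step S_num"
  unfolding represents_def
proof (intro conjI allI)
  show "monoS S_num" unfolding monoS_def S_num_def by blast
qed (simp add: num_step_def ex_defs S_num_def)

lemma der_num: "der S_num (pair n (code_trm (num_trm n)))"
proof (induction n)
  case 0 show ?case by (rule der.intros[of "[]"]) (auto simp: S_num_def)
next
  case (Suc n) show ?case
    by (rule der.intros[of "[pair n (code_trm (num_trm n))]"], simp add: Suc) (auto simp: S_num_def)
qed

lemma sat_num_graph [simp]:
  "sat e (num_graph n y) \<longleftrightarrow> val e y = code_trm (num_trm (val e n))"
proof
  assume *: "sat e (num_graph n y)"
  define R where "R z \<longleftrightarrow> (\<exists>n. z = pair n (code_trm (num_trm n)))" for z
  have "R (val e \<langle>n, y\<rangle>)"
  proof (rule constructible_sound[OF represents_num])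
    fix z assume "S_num R z"
    then show "R z" unfolding S_num_def R_def
    proof (elim disjE exE conjE)
      assume "z = pair 0 (pair 1 0)"
      then show "\<exists>n. z = pair n (code_trm (num_trm n))" by (intro exI[of _ 0]) simp
    next
      fix n y n' assume "z = pair (Suc n) (pair 3 y)" "pair n y = pair n' (code_trm (num_trm n'))"
      then show "\<exists>n. z = pair n (code_trm (num_trm n))" by (intro exI[of _ "Suc n"]) simp
    qed
  qed (use * in \<open>simp add: num_graph_def\<close>)
  then show "val e y = code_trm (num_trm (val e n))" by (auto simp: R_def)
next
  assume "val e y = code_trm (num_trm (val e n))"
  then show "sat e (num_graph n y)"
    using der_num[of "val e n"] unfolding num_graph_def
    by (intro constructible_complete[OF represents_num]) simp
qed

lemma ex_code [simp]:
  "(\<exists>x. (\<exists>p. x = code_fm p) \<and> Q x) \<longleftrightarrow> (\<exists>p. Q (code_fm p))"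
  "(\<exists>x. (\<exists>t. x = code_trm t) \<and> Q x) \<longleftrightarrow> (\<exists>t. Q (code_trm t))"
  by blast+

lemma sat_axiom_schemas:
  "sat e (ex2 (\<lambda>p q. is_fm_fm p \<^bold>\<and> is_fm_fm q \<^bold>\<and> up 2 z \<^bold>= tImp p (tImp q p))) \<longleftrightarrow>
     (\<exists>p q. val e z = code_fm (p \<^bold>\<longrightarrow> q \<^bold>\<longrightarrow> p))" (is ?K)
  "sat e (ex3 (\<lambda>p q r. is_fm_fm p \<^bold>\<and> is_fm_fm q \<^bold>\<and> is_fm_fm r \<^bold>\<and>
       up 3 z \<^bold>= tImp (tImp p (tImp q r)) (tImp (tImp p q) (tImp p r)))) \<longleftrightarrow>
     (\<exists>p q r. val e z = code_fm ((p \<^bold>\<longrightarrow> q \<^bold>\<longrightarrow> r) \<^bold>\<longrightarrow> (p \<^bold>\<longrightarrow> q) \<^bold>\<longrightarrow> p \<^bold>\<longrightarrow> r))" (is ?S)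
  "sat e (ex1 (\<lambda>p. is_fm_fm p \<^bold>\<and> up 1 z \<^bold>= tImp (tImp (tImp p tFalsity) tFalsity) p)) \<longleftrightarrow>
     (\<exists>p. val e z = code_fm (((p \<^bold>\<longrightarrow> Falsity) \<^bold>\<longrightarrow> Falsity) \<^bold>\<longrightarrow> p))" (is ?DN)
  "sat e (ex3 (\<lambda>p t q. is_fm_fm p \<^bold>\<and> is_trm_fm t \<^bold>\<and> subst_graph Zero t p q \<^bold>\<and>
       up 3 z \<^bold>= tImp (tForall p) q)) \<longleftrightarrow>
     (\<exists>p t. val e z = code_fm (Forall p \<^bold>\<longrightarrow> subst_fm 0 t p))" (is ?Inst)
  "sat e (ex3 (\<lambda>p q p'. is_fm_fm p \<^bold>\<and> is_fm_fm q \<^bold>\<and> lift_graph Zero p p' \<^bold>\<and>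
       up 3 z \<^bold>= tImp (tForall (tImp p' q)) (tImp p (tForall q)))) \<longleftrightarrow>
     (\<exists>p q. val e z = code_fm (Forall (lift_fm 0 p \<^bold>\<longrightarrow> q) \<^bold>\<longrightarrow> p \<^bold>\<longrightarrow> Forall q))" (is ?Dist)
  "sat e (disj (map (\<lambda>p. z \<^bold>= \<lceil>p\<rceil>) basic_axioms)) \<longleftrightarrow>
     (\<exists>p\<in>set basic_axioms. val e z = code_fm p)" (is ?Basic)
  "sat e (ex4 (\<lambda>p p0 p1 p2. is_fm_fm p \<^bold>\<and> subst_graph Zero (quote_trm Zero) p p0 \<^bold>\<and>
       lift_graph (num_trm 1) p p1 \<^bold>\<and> subst_graph Zero (quote_trm (Succ (Var 0))) p1 p2 \<^bold>\<and>
       up 4 z \<^bold>= tImp p0 (tImp (tForall (tImp p p2)) (tForall p)))) \<longleftrightarrow>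
     (\<exists>p. val e z = code_fm (subst_fm 0 Zero p \<^bold>\<longrightarrow>
        Forall (p \<^bold>\<longrightarrow> subst_fm 0 (Succ (Var 0)) (lift_fm 1 p)) \<^bold>\<longrightarrow> Forall p))" (is ?Ind)
proof -
  show ?K by (simp add: ex_defs)
  show ?S by (simp add: ex_defs)
  show ?DN by (simp add: ex_defs)
  have "sat (case_nat q (case_nat (code_trm t) (case_nat (code_fm p) e)))
      (subst_graph Zero (Var 1) (Var 2) (Var 0)) \<longleftrightarrow> q = code_fm (subst_fm 0 t p)" for q t p
    by (subst sat_subst_graph[of _ _ t _ p]) simp_all
  then show ?Inst by (simp add: ex_defs)
  have "sat (case_nat p' (case_nat q (case_nat (code_fm p) e)))
      (lift_graph Zero (Var 2) (Var 0)) \<longleftrightarrow> p' = code_fm (lift_fm 0 p)" for q p p'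
    by (subst sat_lift_graph_fm[of _ _ p]) simp_all
  then show ?Dist by (simp add: ex_defs)
  show ?Basic by auto
  let ?e = "\<lambda>p p0 p1 p2. case_nat p2 (case_nat p1 (case_nat p0 (case_nat p e)))"
  have "sat (?e (code_fm p) p0 p1 p2) (subst_graph Zero (quote_trm Zero) (Var 3) (Var 2) \<^bold>\<and>
       lift_graph (num_trm 1) (Var 3) (Var 1) \<^bold>\<and>
       subst_graph Zero (quote_trm (Succ (Var 0))) (Var 1) (Var 0)) \<longleftrightarrow>
       p0 = code_fm (subst_fm 0 Zero p) \<and> p1 = code_fm (lift_fm 1 p) \<and>
       p2 = code_fm (subst_fm 0 (Succ (Var 0)) (lift_fm 1 p))" (is "?L \<longleftrightarrow> ?R") for p p0 p1 p2
  proof -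
    have "sat (?e (code_fm p) p0 p1 p2) (subst_graph Zero (quote_trm Zero) (Var 3) (Var 2)) \<longleftrightarrow>
        p0 = code_fm (subst_fm 0 Zero p)"
      by (subst sat_subst_graph[of _ _ Zero _ p]) simp_all
    moreover have "sat (?e (code_fm p) p0 p1 p2) (lift_graph (num_trm 1) (Var 3) (Var 1)) \<longleftrightarrow>
        p1 = code_fm (lift_fm 1 p)"
      by (subst sat_lift_graph_fm[of _ _ p]) simp_all
    moreover have "sat (?e (code_fm p) p0 (code_fm (lift_fm 1 p)) p2)
        (subst_graph Zero (quote_trm (Succ (Var 0))) (Var 1) (Var 0)) \<longleftrightarrow>
        p2 = code_fm (subst_fm 0 (Succ (Var 0)) (lift_fm 1 p))"
      by (subst sat_subst_graph[of _ _ "Succ (Var 0)" _ "lift_fm 1 p"]) simp_all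
    ultimately show ?thesis by auto
  qed
  note * = this[unfolded sat_connectives]
  have "sat e (ex4 (\<lambda>p p0 p1 p2. is_fm_fm p \<^bold>\<and> subst_graph Zero (quote_trm Zero) p p0 \<^bold>\<and>
       lift_graph (num_trm 1) p p1 \<^bold>\<and> subst_graph Zero (quote_trm (Succ (Var 0))) p1 p2 \<^bold>\<and>
       up 4 z \<^bold>= tImp p0 (tImp (tForall (tImp p p2)) (tForall p)))) \<longleftrightarrow>
     (\<exists>p p0 p1 p2. (p0 = code_fm (subst_fm 0 Zero p) \<and> p1 = code_fm (lift_fm 1 p) \<and>
       p2 = code_fm (subst_fm 0 (Succ (Var 0)) (lift_fm 1 p))) \<and>
       val e z = pair 8 (pair p0 (pair 8 (pair (pair 9 (pair 8 (pair (code_fm p) p2))) (pair 9 (code_fm p))))))"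
    unfolding *[symmetric] by (simp add: ex_defs conj_assoc)
  then show ?Ind by simp
qed

lemma sat_axiom_iff:
  "sat e (axiom_fm z) \<longleftrightarrow>
     (\<exists>p q. val e z = code_fm (p \<^bold>\<longrightarrow> q \<^bold>\<longrightarrow> p)) \<or>
     (\<exists>p q r. val e z = code_fm ((p \<^bold>\<longrightarrow> q \<^bold>\<longrightarrow> r) \<^bold>\<longrightarrow> (p \<^bold>\<longrightarrow> q) \<^bold>\<longrightarrow> p \<^bold>\<longrightarrow> r)) \<or>
     (\<exists>p. val e z = code_fm (((p \<^bold>\<longrightarrow> Falsity) \<^bold>\<longrightarrow> Falsity) \<^bold>\<longrightarrow> p)) \<or>
     (\<exists>p t. val e z = code_fm (Forall p \<^bold>\<longrightarrow> subst_fm 0 t p)) \<or>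
     (\<exists>p q. val e z = code_fm (Forall (lift_fm 0 p \<^bold>\<longrightarrow> q) \<^bold>\<longrightarrow> p \<^bold>\<longrightarrow> Forall q)) \<or>
     (\<exists>p\<in>set basic_axioms. val e z = code_fm p) \<or>
     (\<exists>p. val e z = code_fm (subst_fm 0 Zero p \<^bold>\<longrightarrow>
        Forall (p \<^bold>\<longrightarrow> subst_fm 0 (Succ (Var 0)) (lift_fm 1 p)) \<^bold>\<longrightarrow> Forall p))"
  unfolding axiom_fm_def sat_disj list.set bex_simps sat_axiom_schemas by simp

lemma sat_axiom [simp]: "sat e (axiom_fm z) \<longleftrightarrow> (\<exists>p. PA_axiom p \<and> val e z = code_fm p)"
proof
  have *: "\<exists>p. PA_axiom p \<and> val e z = code_fm p" if "val e z = code_fm p" "PA_axiom p" for p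
    using that by blast
  assume "sat e (axiom_fm z)"
  then show "\<exists>p. PA_axiom p \<and> val e z = code_fm p"
    unfolding sat_axiom_iff
    by (elim disjE exE bexE)
      (erule *, (rule PA_axiom.K PA_axiom.S PA_axiom.DN PA_axiom.Inst PA_axiom.Dist PA_axiom.Ind
         | (rule PA_axiom.Basic, assumption)))+
next
  assume "\<exists>p. PA_axiom p \<and> val e z = code_fm p"
  then obtain p where p: "PA_axiom p" "val e z = code_fm p" by blast
  from p(1) show "sat e (axiom_fm z)"
    unfolding sat_axiom_iff p(2) code_fm_eq
    by cases blast+
qed

definition S_proof :: "(nat \<Rightarrow> bool) \<Rightarrow> nat \<Rightarrow> bool" where
  "S_proof P z \<longleftrightarrow> (\<exists>p. PA_axiom p \<and> z = code_fm p) \<or> (\<exists>p. P (pair 8 (pair p z)) \<and> P p) \<or>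
     (\<exists>p. P p \<and> z = pair 9 p)"

lemma represents_proof: "represents proof_step S_proof"
  unfolding represents_def
proof (intro conjI allI)
  show "monoS S_proof" unfolding monoS_def S_proof_def by blast
qed (simp add: proof_step_def ex_defs S_proof_def)

text \<open>A proof is a list of formulas each of which is an axiom or follows from formulas occurring
  earlier; the number \<open>\<langle>\<langle>a, b\<rangle>, n\<rangle>\<close> codes it if the beta function yields the codes of its entries.\<close>

definition is_proof :: "fm list \<Rightarrow> bool" where
  "is_proof ps \<longleftrightarrow> (\<forall>i<length ps. PA_axiom (ps ! i) \<or>
     (\<exists>q. (q \<^bold>\<longrightarrow> ps ! i) \<in> set (take i ps) \<and> q \<in> set (take i ps)) \<or>
     (\<exists>q\<in>set (take i ps). ps ! i = Forall q))"

definition codes_list :: "nat \<Rightarrow> fm list \<Rightarrow> bool" where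
  "codes_list x ps \<longleftrightarrow> ps \<noteq> [] \<and>
     (\<exists>a b. x = pair (pair a b) (length ps - 1) \<and> (\<forall>i<length ps. beta a b i = code_fm (ps ! i)))"

lemma is_proof_append: "is_proof ps \<Longrightarrow> is_proof qs \<Longrightarrow> is_proof (ps @ qs)"
  unfolding is_proof_def
proof (intro allI impI)
  fix i
  assume ps: "\<forall>i<length ps. PA_axiom (ps ! i) \<or>
     (\<exists>q. (q \<^bold>\<longrightarrow> ps ! i) \<in> set (take i ps) \<and> q \<in> set (take i ps)) \<or>
     (\<exists>q\<in>set (take i ps). ps ! i = Forall q)"
    and qs: "\<forall>i<length qs. PA_axiom (qs ! i) \<or>
     (\<exists>q. (q \<^bold>\<longrightarrow> qs ! i) \<in> set (take i qs) \<and> q \<in> set (take i qs)) \<or>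
     (\<exists>q\<in>set (take i qs). qs ! i = Forall q)"
    and i: "i < length (ps @ qs)"
  show "PA_axiom ((ps @ qs) ! i) \<or>
     (\<exists>q. (q \<^bold>\<longrightarrow> (ps @ qs) ! i) \<in> set (take i (ps @ qs)) \<and> q \<in> set (take i (ps @ qs))) \<or>
     (\<exists>q\<in>set (take i (ps @ qs)). (ps @ qs) ! i = Forall q)"
  proof (cases "i < length ps")
    case True
    then show ?thesis using ps by (simp add: nth_append)
  next
    case False
    then have "i - length ps < length qs" using i by simp
    with qs have "PA_axiom (qs ! (i - length ps)) \<or>
     (\<exists>q. (q \<^bold>\<longrightarrow> qs ! (i - length ps)) \<in> set (take (i - length ps) qs) \<and> q \<in> set (take (i - length ps) qs)) \<or>
     (\<exists>q\<in>set (take (i - length ps) qs). qs ! (i - length ps) = Forall q)" by blast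
    then show ?thesis using False by (auto simp: nth_append)
  qed
qed

lemma is_proof_snoc:
  assumes "is_proof ps"
    "PA_axiom p \<or> (\<exists>q. (q \<^bold>\<longrightarrow> p) \<in> set ps \<and> q \<in> set ps) \<or> (\<exists>q\<in>set ps. p = Forall q)"
  shows "is_proof (ps @ [p])"
  using assms by (auto simp: is_proof_def nth_append less_Suc_eq)

lemma PA_proves_iff: "PA \<turnstile> p \<longleftrightarrow> (\<exists>ps. is_proof ps \<and> ps \<noteq> [] \<and> last ps = p)"
proof
  assume "PA \<turnstile> p"
  then show "\<exists>ps. is_proof ps \<and> ps \<noteq> [] \<and> last ps = p"
  proof induction
    case (Ax p)
    have "is_proof []" by (simp add: is_proof_def)
    from is_proof_snoc[OF this] Ax show ?case by (intro exI[of _ "[] @ [p]"]) auto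
  next
    case (MP p q)
    then obtain ps qs where ps: "is_proof ps" "ps \<noteq> []" "last ps = (p \<^bold>\<longrightarrow> q)"
      and qs: "is_proof qs" "qs \<noteq> []" "last qs = p" by blast
    have "(p \<^bold>\<longrightarrow> q) \<in> set (ps @ qs)" "p \<in> set (ps @ qs)"
      using last_in_set[OF ps(2)] last_in_set[OF qs(2)] ps(3) qs(3) by auto
    then have "is_proof ((ps @ qs) @ [q])"
      using ps(1) qs(1) by (intro is_proof_snoc is_proof_append) blast+
    then show ?case by (intro exI[of _ "(ps @ qs) @ [q]"]) auto
  next
    case (Gen p)
    then obtain ps where "is_proof ps" "ps \<noteq> []" "last ps = p" by blast
    then have "is_proof (ps @ [Forall p])"
      by (intro is_proof_snoc) (auto dest: last_in_set)
    then show ?case by (intro exI[of _ "ps @ [Forall p]"]) auto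
  qed
next
  assume "\<exists>ps. is_proof ps \<and> ps \<noteq> [] \<and> last ps = p"
  then obtain ps where ps: "is_proof ps" "ps \<noteq> []" "last ps = p" by blast
  have "i < length ps \<Longrightarrow> PA \<turnstile> ps ! i" for i
  proof (induction i rule: less_induct)
    case (less i)
    have *: "PA \<turnstile> q" if "q \<in> set (take i ps)" for q
      using that less by (auto simp: in_set_conv_nth)
    show ?case using ps(1) less(2) unfolding is_proof_def by (metis * Ax MP Gen)
  qed
  then show "PA \<turnstile> p" using ps(2,3) by (metis last_conv_nth diff_less length_greater_0_conv zero_less_one)
qed

lemma constr_at_proof:
  "constr_at S_proof a b n \<longleftrightarrow>
     (\<exists>ps. is_proof ps \<and> length ps = Suc n \<and> (\<forall>i\<le>n. beta a b i = code_fm (ps ! i)))"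
proof
  assume *: "constr_at S_proof a b n"
  have "\<exists>p. beta a b i = code_fm p" if "i \<le> n" for i
  proof (rule constr_at_sound[OF _ * _ that])
    show "monoS S_proof" using represents_proof by (simp add: represents_def)
    show "\<exists>p. z = code_fm p" if "S_proof (\<lambda>z. \<exists>p. z = code_fm p) z" for z
      using that unfolding S_proof_def
    proof (elim disjE exE conjE)
      fix p q r assume "pair 8 (pair p z) = code_fm q"
      then show "\<exists>p. z = code_fm p" by (auto simp: code_fm_inv)
    next
      fix p q assume "z = pair 9 p" "p = code_fm q"
      then show "\<exists>p. z = code_fm p" by (intro exI[of _ "Forall q"]) simp
    qed blast
  qed
  then obtain f where f: "\<And>i. i \<le> n \<Longrightarrow> beta a b i = code_fm (f i)" by metis
  define ps where "ps = map f [0..<Suc n]"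
  have len: "length ps = Suc n" by (simp add: ps_def)
  have nth: "ps ! i = f i" if "i \<le> n" for i
    using that unfolding ps_def by (simp del: upt_Suc)
  have mem: "q \<in> set (take i ps)" if "j < i" "i \<le> n" "code_fm q = beta a b j" for i j q
  proof -
    have "q = ps ! j" using that f[of j] nth[of j] by simp
    then show ?thesis using that len by (auto simp: in_set_conv_nth intro!: exI[of _ j])
  qed
  have "is_proof ps"
    unfolding is_proof_def
  proof (intro allI impI)
    fix i assume "i < length ps"
    then have i: "i \<le> n" using len by simp
    then have "S_proof (\<lambda>u. \<exists>j<i. u = beta a b j) (code_fm (ps ! i))"
      using * f nth by (simp add: constr_at_def)
    then show "PA_axiom (ps ! i) \<or>
      (\<exists>q. (q \<^bold>\<longrightarrow> ps ! i) \<in> set (take i ps) \<and> q \<in> set (take i ps)) \<or>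
      (\<exists>q\<in>set (take i ps). ps ! i = Forall q)"
      unfolding S_proof_def
    proof (elim disjE exE conjE)
      fix p j k
      assume "j < i" "pair 8 (pair p (code_fm (ps ! i))) = beta a b j" "k < i" "p = beta a b k"
      moreover have "p = code_fm (f k)" using calculation f[of k] i by simp
      ultimately have "(f k \<^bold>\<longrightarrow> ps ! i) \<in> set (take i ps)" "f k \<in> set (take i ps)"
        using mem[of j i "f k \<^bold>\<longrightarrow> ps ! i"] mem[of k i "f k"] i by simp_all
      then show ?thesis by blast
    next
      fix p j assume "j < i" "p = beta a b j" "code_fm (ps ! i) = pair 9 p"
      moreover have "p = code_fm (f j)" using calculation f[of j] i by simp
      moreover have "code_fm (ps ! i) = code_fm (Forall (f j))" using calculation by simp
      then have "ps ! i = Forall (f j)" by (simp only: code_fm_eq)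
      ultimately show ?thesis using mem[of j i "f j"] i by auto
    qed auto
  qed
  then show "\<exists>ps. is_proof ps \<and> length ps = Suc n \<and> (\<forall>i\<le>n. beta a b i = code_fm (ps ! i))"
    using len f nth by auto
next
  assume "\<exists>ps. is_proof ps \<and> length ps = Suc n \<and> (\<forall>i\<le>n. beta a b i = code_fm (ps ! i))"
  then obtain ps where ps: "is_proof ps" "length ps = Suc n"
    and b: "\<And>i. i \<le> n \<Longrightarrow> beta a b i = code_fm (ps ! i)" by blast
  show "constr_at S_proof a b n"
    unfolding constr_at_def
  proof (intro allI impI)
    fix i assume i: "i \<le> n"
    have mem: "\<exists>j<i. code_fm q = beta a b j" if "q \<in> set (take i ps)" for q
      using that i ps(2) b by (auto simp: in_set_conv_nth)
    have "PA_axiom (ps ! i) \<or>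
      (\<exists>q. (q \<^bold>\<longrightarrow> ps ! i) \<in> set (take i ps) \<and> q \<in> set (take i ps)) \<or>
      (\<exists>q\<in>set (take i ps). ps ! i = Forall q)"
      using ps i by (simp add: is_proof_def)
    then show "S_proof (\<lambda>u. \<exists>j<i. u = beta a b j) (beta a b i)"
      unfolding S_proof_def b[OF i]
    proof (elim disjE exE conjE bexE)
      fix q assume "(q \<^bold>\<longrightarrow> ps ! i) \<in> set (take i ps)" "q \<in> set (take i ps)"
      from mem[OF this(1)] mem[OF this(2)] show
        "(\<exists>p. PA_axiom p \<and> code_fm (ps ! i) = code_fm p) \<or>
         (\<exists>p. (\<exists>j<i. pair 8 (pair p (code_fm (ps ! i))) = beta a b j) \<and> (\<exists>j<i. p = beta a b j)) \<or>
         (\<exists>p. (\<exists>j<i. p = beta a b j) \<and> code_fm (ps ! i) = pair 9 p)" by auto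
    next
      fix q assume "q \<in> set (take i ps)" "ps ! i = Forall q"
      with mem[OF this(1)] show
        "(\<exists>p. PA_axiom p \<and> code_fm (ps ! i) = code_fm p) \<or>
         (\<exists>p. (\<exists>j<i. pair 8 (pair p (code_fm (ps ! i))) = beta a b j) \<and> (\<exists>j<i. p = beta a b j)) \<or>
         (\<exists>p. (\<exists>j<i. p = beta a b j) \<and> code_fm (ps ! i) = pair 9 p)" by auto
    qed blast
  qed
qed

theorem sat_Prf:
  "sat e (Prf x y) \<longleftrightarrow> (\<exists>ps. is_proof ps \<and> codes_list (val e x) ps \<and> val e y = code_fm (last ps))"
proof -
  have "sat e (Prf x y) \<longleftrightarrow> (\<exists>a b n. val e x = pair (pair a b) n \<and> val e y = beta a b n \<and>
      constr_at S_proof a b n)"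
    by (simp add: Prf_def ex_defs sat_constr_seq[OF represents_proof])
  also have "\<dots> \<longleftrightarrow> (\<exists>ps. is_proof ps \<and> codes_list (val e x) ps \<and> val e y = code_fm (last ps))"
    unfolding constr_at_proof
  proof (intro iffI; elim exE conjE)
    fix a b n ps
    assume *: "val e x = pair (pair a b) n" "val e y = beta a b n" "is_proof ps"
      "length ps = Suc n" "\<forall>i\<le>n. beta a b i = code_fm (ps ! i)"
    then have "ps \<noteq> []" by auto
    with * show "\<exists>ps. is_proof ps \<and> codes_list (val e x) ps \<and> val e y = code_fm (last ps)"
      by (intro exI[of _ ps]) (auto simp: codes_list_def last_conv_nth less_Suc_eq_le)
  next
    fix ps assume *: "is_proof ps" "codes_list (val e x) ps" "val e y = code_fm (last ps)"
    then obtain a b where ab: "val e x = pair (pair a b) (length ps - 1)" "ps \<noteq> []"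
      "\<forall>i<length ps. beta a b i = code_fm (ps ! i)" unfolding codes_list_def by blast
    obtain n where n: "length ps = Suc n" using ab(2) by (cases ps) auto
    show "\<exists>a b n. val e x = pair (pair a b) n \<and> val e y = beta a b n \<and>
      (\<exists>ps. is_proof ps \<and> length ps = Suc n \<and> (\<forall>i\<le>n. beta a b i = code_fm (ps ! i)))"
      using * ab n by (intro exI[of _ a] exI[of _ b] exI[of _ n] conjI exI[of _ ps])
        (auto simp: last_conv_nth)
  qed
  finally show ?thesis .
qed

lemma codes_list_ex: "ps \<noteq> [] \<Longrightarrow> \<exists>x. codes_list x ps"
proof -
  assume "ps \<noteq> []"
  moreover obtain a b where "\<forall>i<length ps. beta a b i = map code_fm ps ! i"
    using beta_surj[of "map code_fm ps"] by auto
  ultimately show ?thesis unfolding codes_list_def by auto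
qed

theorem sat_Prov: "sat e (Prov y) \<longleftrightarrow> (\<exists>p. val e y = code_fm p \<and> PA \<turnstile> p)"
proof -
  have "sat e (Prov y) \<longleftrightarrow> (\<exists>x ps. is_proof ps \<and> codes_list x ps \<and> val e y = code_fm (last ps))"
    by (simp add: Prov_def ex_defs sat_Prf)
  also have "\<dots> \<longleftrightarrow> (\<exists>ps. is_proof ps \<and> ps \<noteq> [] \<and> val e y = code_fm (last ps))"
    using codes_list_ex unfolding codes_list_def by metis
  also have "\<dots> \<longleftrightarrow> (\<exists>p. val e y = code_fm p \<and> PA \<turnstile> p)"
    unfolding PA_proves_iff by blast
  finally show ?thesis .
qed

theorem sat_Box: "sat e (Box p) \<longleftrightarrow> PA \<turnstile> subst_fm 0 (num_trm (e 0)) p"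
proof -
  have "sat (case_nat y (case_nat (code_trm (num_trm (e 0))) e)) (subst_graph Zero (Var 1) \<lceil>p\<rceil> (Var 0))
    \<longleftrightarrow> y = code_fm (subst_fm 0 (num_trm (e 0)) p)" for y
    by (subst sat_subst_graph[of _ _ "num_trm (e 0)" _ p]) simp_all
  then show ?thesis by (simp add: Box_def ex_defs sat_Prov)
qed

theorem sat_cf:
  "sat e (cf (Suc n) A) \<longleftrightarrow>
     (\<forall>k. PA \<turnstile> subst_fm 0 (num_trm k) ((Box ^^ n) (Neg (Prf (Var 0) \<lceil>A\<rceil>))))"
  by (simp add: cf_def sat_Box)

end

theory Submission
  imports Defs
begin

text \<open>Call \<open>A\<close> refutable if PA proves \<open>Neg A\<close> or some \<open>cf n A\<close>.  Since PA is sound, a provable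
  sentence is not refutable.  Being refutable is a positive (Sigma 1) property of the code, witnessed
  by all sufficiently large bounds on its quantifiers.  Let \<open>A\<close> be the Rosser sentence "there is a
  witness that \<open>A\<close> is refutable such that nothing up to it witnesses that \<open>Neg A\<close> is refutable".
  If \<open>A\<close> or \<open>Neg A\<close> were refutable, then PA would decide the comparison of the least witnesses: either
  \<open>A\<close> is provable and refutable, or \<open>Neg A\<close> is.  Both are impossible, so neither \<open>A\<close> nor \<open>Neg A\<close> is
  refutable.\<close>


section \<open>Lifting and substitution\<close>

lemma lift_lift_trm: "i \<le> k \<Longrightarrow> lift_trm (Suc k) (lift_trm i t) = lift_trm i (lift_trm k t)"
  by (induction t) auto

lemma subst_lift_trm [simp]: "subst_trm k s (lift_trm k t) = t"
  by (induction t) auto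

lemma subst_lift_fm [simp]: "subst_fm k s (lift_fm k p) = p"
  by (induction p arbitrary: k s) auto

lemma subst_lift_trm_le: "i \<le> k \<Longrightarrow> subst_trm (Suc k) (lift_trm i s) (lift_trm i t) = lift_trm i (subst_trm k s t)"
  by (induction t) auto

lemma subst_lift_trm_0 [simp]: "subst_trm (Suc k) (lift_trm 0 s) (lift_trm 0 t) = lift_trm 0 (subst_trm k s t)"
  by (simp add: subst_lift_trm_le)

text \<open>The inner substitution produces p(x + 1) in the form in which \<open>Ind\<close> writes
  it; instantiating x with t then has to yield p(t + 1).\<close>

lemma subst_Succ_shift_trm:
  "subst_trm k t (subst_trm k (Succ (Var k)) (lift_trm (Suc k) u)) = subst_trm k (Succ t) u"
  by (induction u) auto

lemma subst_Succ_shift_fm: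
  "subst_fm k t (subst_fm k (Succ (Var k)) (lift_fm (Suc k) p)) = subst_fm k (Succ t) p"
  by (induction p arbitrary: k t) (auto simp: subst_Succ_shift_trm)

text \<open>Opening a lifted quantifier with the variable of an enclosing generalization recovers
  its body unchanged.\<close>

lemma subst_Var_trm: "subst_trm k (Var k) (lift_trm (Suc k) t) = t"
  by (induction t) auto

lemma subst_Var_fm: "subst_fm k (Var k) (lift_fm (Suc k) p) = p"
  by (induction p arbitrary: k) (auto simp: subst_Var_trm)

lemma closed_lift_trm: "closed_trm k t \<Longrightarrow> lift_trm k t = t"
  by (induction t) auto

lemma closed_subst_trm: "closed_trm k t \<Longrightarrow> subst_trm k s t = t"
  by (induction t) auto

lemma closed_subst_fm: "closed_fm k p \<Longrightarrow> subst_fm k s p = p"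
  by (induction p arbitrary: k s) (auto simp: closed_subst_trm)

lemma closed_trm_mono: "closed_trm k t \<Longrightarrow> k \<le> l \<Longrightarrow> closed_trm l t"
  by (induction t) auto

lemma closed_fm_mono: "closed_fm k p \<Longrightarrow> k \<le> l \<Longrightarrow> closed_fm l p"
proof (induction p arbitrary: k l)
  case (Forall p)
  show ?case using Forall.IH[of "Suc k" "Suc l"] Forall.prems by simp
qed (auto simp: closed_trm_mono)

lemma closed_num [simp]: "closed_trm k (num_trm n)"
  by (induction n) auto

lemma lift_num [simp]: "lift_trm k (num_trm n) = num_trm n"
  by (simp add: closed_lift_trm)

lemma subst_num [simp]: "subst_trm k s (num_trm n) = num_trm n"
  by (simp add: closed_subst_trm)

lemma closed_lift_0 [simp]: "closed_trm (Suc k) (lift_trm 0 t) \<longleftrightarrow> closed_trm k t"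
  by (induction t) auto

lemma closed_subst_closed_trm: "closed_trm (Suc k) t \<Longrightarrow> k' \<le> k \<Longrightarrow> closed_trm k s \<Longrightarrow> closed_trm k (subst_trm k' s t)"
  by (induction t) auto

lemma closed_subst_closed_fm: "closed_fm (Suc k) p \<Longrightarrow> k' \<le> k \<Longrightarrow> closed_trm k s \<Longrightarrow> closed_fm k (subst_fm k' s p)"
  by (induction p arbitrary: k k' s) (auto simp: closed_subst_closed_trm)

text \<open>No index above \<open>j\<close> is free in \<open>u\<close>, so once \<open>t\<close> is
  put in, a substitution at \<open>k\<close> can only act inside \<open>t\<close>.\<close>

lemma subst_subst_trm:
  "closed_trm (Suc j) u \<Longrightarrow> j \<le> k \<Longrightarrow>
    subst_trm k s (subst_trm j t u) = subst_trm j (subst_trm k s t) u"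
  by (induction u) auto

lemma subst_subst_fm:
  "closed_fm (Suc j) p \<Longrightarrow> j \<le> k \<Longrightarrow>
    subst_fm k s (subst_fm j t p) = subst_fm j (subst_trm k s t) p"
  by (induction p arbitrary: j k s t) (auto simp: subst_subst_trm)

lemma up_simps [simp]:
  "up 0 t = t"
  "up (Suc n) t = lift_trm 0 (up n t)"
  by (simp_all add: up_def)

lemma subst_connectives [simp]:
  "subst_fm k s (Neg p) = Neg (subst_fm k s p)"
  "subst_fm k s (p \<^bold>\<and> q) = (subst_fm k s p \<^bold>\<and> subst_fm k s q)"
  "subst_fm k s (p \<^bold>\<or> q) = (subst_fm k s p \<^bold>\<or> subst_fm k s q)"
  "subst_fm k s (Ex p) = Ex (subst_fm (Suc k) (lift_trm 0 s) p)"
  by (simp_all add: Neg_def And_def Or_def Ex_def)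

lemma closed_connectives [simp]:
  "closed_fm k (Neg p) \<longleftrightarrow> closed_fm k p"
  "closed_fm k (p \<^bold>\<and> q) \<longleftrightarrow> closed_fm k p \<and> closed_fm k q"
  "closed_fm k (p \<^bold>\<or> q) \<longleftrightarrow> closed_fm k p \<and> closed_fm k q"
  "closed_fm k (Ex p) \<longleftrightarrow> closed_fm (Suc k) p"
  by (simp_all add: Neg_def And_def Or_def Ex_def)

lemma leq_fm_eq: "(s \<^bold>\<le> t) = Ex (lift_trm 0 t \<^bold>= Add (lift_trm 0 s) (Var 0))"
  by (simp add: leq_fm_def ex1_def)

lemma subst_leq [simp]: "subst_fm k s (t \<^bold>\<le> u) = (subst_trm k s t \<^bold>\<le> subst_trm k s u)"
  by (simp add: leq_fm_eq)

lemma closed_leq [simp]: "closed_fm k (s \<^bold>\<le> t) \<longleftrightarrow> closed_trm k s \<and> closed_trm k t"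
  by (auto simp: leq_fm_eq)


section \<open>Derivations in Peano Arithmetic\<close>

text \<open>Derivations from hypotheses use generalization only on theorems, so that the deduction
  theorem holds without a side condition.\<close>

inductive derives :: "fm set \<Rightarrow> fm \<Rightarrow> bool"  (infix "\<tturnstile>" 40) for H where
  provable: "PA \<turnstile> p \<Longrightarrow> H \<tturnstile> p"
| hyp: "p \<in> H \<Longrightarrow> H \<tturnstile> p"
| detach: "H \<tturnstile> p \<^bold>\<longrightarrow> q \<Longrightarrow> H \<tturnstile> p \<Longrightarrow> H \<tturnstile> q"

lemma derives_empty: "{} \<tturnstile> p \<Longrightarrow> PA \<turnstile> p"
proof (induction rule: derives.induct)
  case (detach p q) then show ?case using MP[of p q] by simp
qed auto

lemma derives_ax: "PA_axiom p \<Longrightarrow> H \<tturnstile> p"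
  by (simp add: Ax provable)

lemma imp_const: "H \<tturnstile> q \<Longrightarrow> H \<tturnstile> p \<^bold>\<longrightarrow> q"
  by (rule detach[OF derives_ax[OF PA_axiom.K]])

lemma imp_refl: "H \<tturnstile> p \<^bold>\<longrightarrow> p"
  by (rule detach[OF detach[OF derives_ax[OF PA_axiom.S[of p "p \<^bold>\<longrightarrow> p" p]] derives_ax[OF PA_axiom.K]]
      derives_ax[OF PA_axiom.K]])

lemma imp_intro: "insert p H \<tturnstile> q \<Longrightarrow> H \<tturnstile> p \<^bold>\<longrightarrow> q"
proof (induction rule: derives.induct)
  case (hyp q)
  then show ?case using imp_refl imp_const derives.hyp by (cases "q = p") auto
next
  case (detach q r)
  from derives.detach[OF derives.detach[OF derives_ax[OF PA_axiom.S] detach.IH(1)] detach.IH(2)] show ?case .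
qed (rule imp_const[OF provable])

lemma PA_imp_intro: "{p} \<tturnstile> q \<Longrightarrow> PA \<turnstile> p \<^bold>\<longrightarrow> q"
  by (rule derives_empty) (rule imp_intro)

lemma neg_intro: "insert p H \<tturnstile> Falsity \<Longrightarrow> H \<tturnstile> Neg p"
  unfolding Neg_def by (rule imp_intro)

lemma neg_elim: "H \<tturnstile> Neg p \<Longrightarrow> H \<tturnstile> p \<Longrightarrow> H \<tturnstile> q"
  unfolding Neg_def by (rule detach[OF derives_ax[OF PA_axiom.DN] imp_const[OF detach]])

lemma neg_negD: "H \<tturnstile> Neg (Neg p) \<Longrightarrow> H \<tturnstile> p"
  unfolding Neg_def by (rule detach[OF derives_ax[OF PA_axiom.DN]])

lemma hyps [simp]: "insert p H \<tturnstile> p" "insert q (insert p H) \<tturnstile> p"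
  by (simp_all add: hyp)

lemma weaken: "H \<tturnstile> p \<Longrightarrow> H \<subseteq> H' \<Longrightarrow> H' \<tturnstile> p"
proof (induction rule: derives.induct)
  case (provable p) then show ?case by (simp add: derives.provable)
next
  case (hyp p) then show ?case by (intro derives.hyp) auto
next
  case (detach p q) then show ?case using derives.detach[of H' p q] by simp
qed

lemma weaken_insert: "H \<tturnstile> p \<Longrightarrow> insert q H \<tturnstile> p"
  by (rule weaken) auto

lemma and_intro: assumes "H \<tturnstile> p" "H \<tturnstile> q" shows "H \<tturnstile> p \<^bold>\<and> q"
  unfolding And_def
proof (rule neg_intro)
  let ?H = "insert (p \<^bold>\<longrightarrow> Neg q) H"
  have "?H \<tturnstile> Neg q" using detach[OF hyps(1) weaken_insert[OF assms(1)]] .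
  then show "?H \<tturnstile> Falsity" using weaken_insert[OF assms(2)] by (rule neg_elim)
qed

lemma and_elim1: assumes "H \<tturnstile> p \<^bold>\<and> q" shows "H \<tturnstile> p"
proof (rule neg_negD, rule neg_intro)
  have "insert (Neg p) H \<tturnstile> p \<^bold>\<longrightarrow> Neg q"
    by (rule imp_intro, rule neg_elim[of _ p]) simp_all
  with weaken_insert[OF assms] show "insert (Neg p) H \<tturnstile> Falsity"
    unfolding And_def by (rule neg_elim)
qed

lemma and_elim2: assumes "H \<tturnstile> p \<^bold>\<and> q" shows "H \<tturnstile> q"
proof (rule neg_negD, rule neg_intro)
  have "insert (Neg q) H \<tturnstile> p \<^bold>\<longrightarrow> Neg q" by (rule imp_const) simp
  with weaken_insert[OF assms] show "insert (Neg q) H \<tturnstile> Falsity"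
    unfolding And_def by (rule neg_elim)
qed

lemma all_elim: "H \<tturnstile> Forall p \<Longrightarrow> H \<tturnstile> subst_fm 0 t p"
  by (rule detach[OF derives_ax[OF PA_axiom.Inst]])

lemma PA_subst: "PA \<turnstile> p \<Longrightarrow> PA \<turnstile> subst_fm 0 t p"
  by (rule MP[OF Ax[OF PA_axiom.Inst] Gen])

text \<open>The lifted hypothesis is instantiated at the variable to be generalized;
  \<open>Dist\<close> then moves the generalization past it, since lifting keeps that variable out
  of the hypothesis.\<close>

lemma PA_all_mono:
  assumes "PA \<turnstile> p \<^bold>\<longrightarrow> q" shows "PA \<turnstile> Forall p \<^bold>\<longrightarrow> Forall q"
proof -
  have "{lift_fm 0 (Forall p)} \<tturnstile> subst_fm 0 (Var 0) (lift_fm 1 p)"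
    by (rule all_elim) (simp add: hyp)
  then have "{lift_fm 0 (Forall p)} \<tturnstile> q"
    unfolding One_nat_def subst_Var_fm by (rule detach[OF provable[OF assms]])
  then have "PA \<turnstile> Forall (lift_fm 0 (Forall p) \<^bold>\<longrightarrow> q)" by (rule Gen[OF PA_imp_intro])
  then show ?thesis by (rule MP[OF Ax[OF PA_axiom.Dist]])
qed

lemma ex_intro: assumes "H \<tturnstile> subst_fm 0 t p" shows "H \<tturnstile> Ex p"
  unfolding Ex_def
proof (rule neg_intro)
  have "insert (Forall (Neg p)) H \<tturnstile> subst_fm 0 t (Neg p)" by (rule all_elim) simp
  then show "insert (Forall (Neg p)) H \<tturnstile> Falsity"
    unfolding subst_connectives by (rule neg_elim[OF _ weaken_insert[OF assms]])
qed

lemma PA_ex_mono: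
  assumes "PA \<turnstile> p \<^bold>\<longrightarrow> q" shows "PA \<turnstile> Ex p \<^bold>\<longrightarrow> Ex q"
proof -
  have "{p, Neg q} \<tturnstile> Falsity"
    by (rule neg_elim[OF hyp detach[OF provable[OF assms] hyp]]) simp_all
  then have "PA \<turnstile> Neg q \<^bold>\<longrightarrow> Neg p" by (intro PA_imp_intro neg_intro)
  then have "PA \<turnstile> Forall (Neg q) \<^bold>\<longrightarrow> Forall (Neg p)" by (rule PA_all_mono)
  from detach[OF provable[OF this] hyp] have "{Forall (Neg q), Ex p} \<tturnstile> Falsity"
    unfolding Ex_def by (rule neg_elim[OF hyp, rotated]) simp_all
  then show ?thesis unfolding Ex_def[of q] by (intro PA_imp_intro neg_intro)
qed

lemma PA_neg_ex: assumes "PA \<turnstile> Neg p" shows "PA \<turnstile> Neg (Ex p)"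
proof -
  have "{Ex p} \<tturnstile> Falsity"
    unfolding Ex_def by (rule neg_elim[of _ "Forall (Neg p)"]) (simp_all add: hyp provable Gen assms)
  then show ?thesis by (intro derives_empty neg_intro)
qed

section \<open>Induction, equality and addition inside PA\<close>

lemma PA_induct:
  assumes "PA \<turnstile> subst_fm 0 Zero p"
    "PA \<turnstile> p \<^bold>\<longrightarrow> subst_fm 0 (Succ (Var 0)) (lift_fm 1 p)"
  shows "PA \<turnstile> subst_fm 0 t p"
  by (rule MP[OF Ax[OF PA_axiom.Inst] MP[OF MP[OF Ax[OF PA_axiom.Ind] assms(1)] Gen[OF assms(2)]]])

text \<open>Each substitution fills index 0 and lowers the remaining ones, so four in a row fill the
  indices 0 to 3; the lifts protect the inserted terms from the substitutions that follow.\<close>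

lemma PA_basic: "p \<in> set basic_axioms \<Longrightarrow>
  PA \<turnstile> subst_fm 0 s (subst_fm 0 (lift_trm 0 t) (subst_fm 0 (lift_trm 0 (lift_trm 0 u))
    (subst_fm 0 (lift_trm 0 (lift_trm 0 (lift_trm 0 v))) p)))"
  by (intro PA_subst Ax PA_axiom.Basic)

lemma basic_instances:
  "PA \<turnstile> v \<^bold>= v"
  "PA \<turnstile> v \<^bold>= u \<^bold>\<longrightarrow> v \<^bold>= t \<^bold>\<longrightarrow> u \<^bold>= t"
  "PA \<turnstile> v \<^bold>= u \<^bold>\<longrightarrow> Succ v \<^bold>= Succ u"
  "PA \<turnstile> v \<^bold>= u \<^bold>\<longrightarrow> t \<^bold>= s \<^bold>\<longrightarrow> Add v t \<^bold>= Add u s"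
  "PA \<turnstile> v \<^bold>= u \<^bold>\<longrightarrow> t \<^bold>= s \<^bold>\<longrightarrow> Mul v t \<^bold>= Mul u s"
  "PA \<turnstile> Neg (Succ v \<^bold>= Zero)"
  "PA \<turnstile> Succ v \<^bold>= Succ u \<^bold>\<longrightarrow> v \<^bold>= u"
  "PA \<turnstile> Add v Zero \<^bold>= v"
  "PA \<turnstile> Add v (Succ u) \<^bold>= Succ (Add v u)"
  "PA \<turnstile> Mul v Zero \<^bold>= Zero"
  "PA \<turnstile> Mul v (Succ u) \<^bold>= Add (Mul v u) v"
  using PA_basic[of "basic_axioms ! 0" s t u v] PA_basic[of "basic_axioms ! 1" s t u v]
    PA_basic[of "basic_axioms ! 2" s t u v] PA_basic[of "basic_axioms ! 3" s t u v]
    PA_basic[of "basic_axioms ! 4" s t u v] PA_basic[of "basic_axioms ! 5" s t u v]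
    PA_basic[of "basic_axioms ! 6" s t u v] PA_basic[of "basic_axioms ! 7" s t u v]
    PA_basic[of "basic_axioms ! 8" s t u v] PA_basic[of "basic_axioms ! 9" s t u v]
    PA_basic[of "basic_axioms ! 10" s t u v]
  by (simp_all add: basic_axioms_def)

lemma eq_refl: "H \<tturnstile> t \<^bold>= t"
  by (rule provable[OF basic_instances(1)])

lemma eq_sym: "H \<tturnstile> s \<^bold>= t \<Longrightarrow> H \<tturnstile> t \<^bold>= s"
  by (rule detach[OF detach[OF provable[OF basic_instances(2)]] eq_refl])

lemma eq_trans: "H \<tturnstile> s \<^bold>= t \<Longrightarrow> H \<tturnstile> t \<^bold>= u \<Longrightarrow> H \<tturnstile> s \<^bold>= u"
  by (rule detach[OF detach[OF provable[OF basic_instances(2)] eq_sym]])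

lemma eq_Succ: "H \<tturnstile> s \<^bold>= t \<Longrightarrow> H \<tturnstile> Succ s \<^bold>= Succ t"
  by (rule detach[OF provable[OF basic_instances(3)]])

lemma eq_Add: "H \<tturnstile> s \<^bold>= t \<Longrightarrow> H \<tturnstile> u \<^bold>= v \<Longrightarrow> H \<tturnstile> Add s u \<^bold>= Add t v"
  by (rule detach[OF detach[OF provable[OF basic_instances(4)]]])

lemma eq_Mul: "H \<tturnstile> s \<^bold>= t \<Longrightarrow> H \<tturnstile> u \<^bold>= v \<Longrightarrow> H \<tturnstile> Mul s u \<^bold>= Mul t v"
  by (rule detach[OF detach[OF provable[OF basic_instances(5)]]])

lemma eq_SuccD: "H \<tturnstile> Succ s \<^bold>= Succ t \<Longrightarrow> H \<tturnstile> s \<^bold>= t"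
  by (rule detach[OF provable[OF basic_instances(7)]])

lemma Add_Zero: "H \<tturnstile> Add t Zero \<^bold>= t"
  by (rule provable[OF basic_instances(8)])

lemma Add_Succ: "H \<tturnstile> Add s (Succ t) \<^bold>= Succ (Add s t)"
  by (rule provable[OF basic_instances(9)])

text \<open>The axioms recurse on the second summand, so this law and the next one require induction
  inside PA.\<close>

lemma Zero_Add: "PA \<turnstile> Add Zero t \<^bold>= t"
proof -
  have "PA \<turnstile> subst_fm 0 t (Add Zero (Var 0) \<^bold>= Var 0)"
  proof (rule PA_induct)
    show "PA \<turnstile> subst_fm 0 Zero (Add Zero (Var 0) \<^bold>= Var 0)"
      by (simp add: basic_instances)
    show "PA \<turnstile> (Add Zero (Var 0) \<^bold>= Var 0) \<^bold>\<longrightarrow>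
        subst_fm 0 (Succ (Var 0)) (lift_fm 1 (Add Zero (Var 0) \<^bold>= Var 0))"
      using eq_trans[OF Add_Succ eq_Succ[OF hyps(1)]] by (simp add: PA_imp_intro)
  qed
  then show ?thesis by simp
qed

lemma Succ_Add: "PA \<turnstile> Add (Succ s) t \<^bold>= Succ (Add s t)"
proof -
  let ?p = "Add (Succ (lift_trm 0 s)) (Var 0) \<^bold>= Succ (Add (lift_trm 0 s) (Var 0))"
  have "PA \<turnstile> subst_fm 0 t ?p"
  proof (rule PA_induct)
    have "{} \<tturnstile> Add (Succ s) Zero \<^bold>= Succ (Add s Zero)"
      by (rule eq_trans[OF Add_Zero eq_Succ[OF eq_sym[OF Add_Zero]]])
    then show "PA \<turnstile> subst_fm 0 Zero ?p" by (simp add: derives_empty)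
    \<comment> \<open>The parameter \<open>s\<close> was lifted to stay clear of the induction
      variable; after an exchange of the two lifts, the one contributed by \<open>Ind\<close>
      cancels against the substitution.\<close>
    have [simp]: "subst_trm 0 t (lift_trm (Suc 0) (lift_trm 0 s)) = lift_trm 0 s" for t
      by (simp add: lift_lift_trm)
    show "PA \<turnstile> ?p \<^bold>\<longrightarrow> subst_fm 0 (Succ (Var 0)) (lift_fm 1 ?p)"
      using eq_trans[OF Add_Succ eq_Succ[OF eq_trans[OF hyps(1) eq_sym[OF Add_Succ]]]]
      by (simp add: PA_imp_intro)
  qed
  then show ?thesis by simp
qed

text \<open>Weakening the step of \<open>Ind\<close> by axiom \<open>K\<close> turns induction into
  a case distinction between zero and successors.\<close>

lemma PA_cases:
  assumes "PA \<turnstile> subst_fm 0 Zero p" "PA \<turnstile> Forall (subst_fm 0 (Succ (Var 0)) (lift_fm 1 p))"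
  shows "PA \<turnstile> Forall p"
  using MP[OF MP[OF Ax[OF PA_axiom.Ind] assms(1)] MP[OF PA_all_mono[OF Ax[OF PA_axiom.K]] assms(2)]] .


section \<open>Deciding bounded statements\<close>

lemma closed_lift_fm: "closed_fm k p \<Longrightarrow> lift_fm k p = p"
  by (induction p arbitrary: k) (simp_all add: closed_lift_trm)

lemma lift_leq: "lift_fm k (s \<^bold>\<le> t) = (lift_trm k s \<^bold>\<le> lift_trm k t)"
  by (simp add: leq_fm_eq Ex_def Neg_def lift_lift_trm)

section \<open>Numerals and the order inside PA\<close>

lemma numeral_Add: "H \<tturnstile> Add (num_trm m) (num_trm n) \<^bold>= num_trm (m + n)"
  by (induction n) (auto intro: Add_Zero eq_trans[OF Add_Succ eq_Succ])

lemma numeral_le: "i \<le> n \<Longrightarrow> H \<tturnstile> num_trm i \<^bold>\<le> num_trm n"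
proof -
  assume "i \<le> n"
  from eq_sym[OF numeral_Add[of _ i "n - i"]] have "H \<tturnstile> num_trm n \<^bold>= Add (num_trm i) (num_trm (n - i))"
    using \<open>i \<le> n\<close> by simp
  then show ?thesis
    unfolding leq_fm_eq by (intro ex_intro[of _ "num_trm (n - i)"]) simp
qed

lemma Zero_le: "PA \<turnstile> Zero \<^bold>\<le> t"
  unfolding leq_fm_eq
  by (rule derives_empty, rule ex_intro[of _ t]) (simp add: eq_sym provable Zero_Add)

lemma not_Succ_le_Zero: "PA \<turnstile> Neg (Succ t \<^bold>\<le> Zero)"
  unfolding leq_fm_eq lift_trm.simps
proof (intro PA_neg_ex derives_empty neg_intro)
  let ?H = "{Zero \<^bold>= Add (Succ (lift_trm 0 t)) (Var 0)}"
  have "?H \<tturnstile> Succ (Add (lift_trm 0 t) (Var 0)) \<^bold>= Zero"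
    by (rule eq_sym[OF eq_trans[OF hyps(1) provable[OF Succ_Add]]])
  then show "?H \<tturnstile> Falsity"
    using neg_elim[OF provable[OF basic_instances(6)]] by blast
qed

lemma Succ_le_SuccD: "PA \<turnstile> Succ s \<^bold>\<le> Succ t \<^bold>\<longrightarrow> s \<^bold>\<le> t"
  unfolding leq_fm_eq lift_trm.simps
proof (intro PA_ex_mono PA_imp_intro)
  show "{Succ (lift_trm 0 t) \<^bold>= Add (Succ (lift_trm 0 s)) (Var 0)} \<tturnstile>
      lift_trm 0 t \<^bold>= Add (lift_trm 0 s) (Var 0)"
    by (rule eq_SuccD[OF eq_trans[OF hyps(1) provable[OF Succ_Add]]])
qed

lemma Succ_le_SuccI: "PA \<turnstile> s \<^bold>\<le> t \<^bold>\<longrightarrow> Succ s \<^bold>\<le> Succ t"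
  unfolding leq_fm_eq lift_trm.simps
proof (intro PA_ex_mono PA_imp_intro)
  show "{lift_trm 0 t \<^bold>= Add (lift_trm 0 s) (Var 0)} \<tturnstile>
      Succ (lift_trm 0 t) \<^bold>= Add (Succ (lift_trm 0 s)) (Var 0)"
    by (rule eq_trans[OF eq_Succ[OF hyps(1)] eq_sym[OF provable[OF Succ_Add]]])
qed

lemma subst_num_Succ: "subst_fm 0 (num_trm i) (subst_fm 0 (Succ (Var 0)) (lift_fm 1 p)) = subst_fm 0 (num_trm (Suc i)) p"
  using subst_Succ_shift_fm[of 0] by simp

text \<open>Induction on \<open>n\<close> outside PA: \<open>PA_cases\<close> splits off x = 0, and
  the successor case is the claim for p(x + 1) with a bound smaller by one. For \<open>n = 0\<close>
  the successor case is vacuous.\<close>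

lemma PA_all_below:
  assumes "\<And>i. i \<le> n \<Longrightarrow> PA \<turnstile> subst_fm 0 (num_trm i) p"
  shows "PA \<turnstile> Forall (Var 0 \<^bold>\<le> num_trm n \<^bold>\<longrightarrow> p)"
  using assms
proof (induction n arbitrary: p)
  case 0
  show ?case
  proof (rule PA_cases)
    show "PA \<turnstile> subst_fm 0 Zero (Var 0 \<^bold>\<le> num_trm 0 \<^bold>\<longrightarrow> p)"
      using derives_empty[OF imp_const[OF provable[OF 0[of 0]]]] by simp
    have "{Succ (Var 0) \<^bold>\<le> Zero} \<tturnstile> q" for q
      by (rule neg_elim[OF provable[OF not_Succ_le_Zero] hyps(1)])
    then show "PA \<turnstile> Forall (subst_fm 0 (Succ (Var 0)) (lift_fm 1 (Var 0 \<^bold>\<le> num_trm 0 \<^bold>\<longrightarrow> p)))"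
      by (simp add: lift_leq Gen PA_imp_intro)
  qed
next
  case (Suc n)
  let ?p = "subst_fm 0 (Succ (Var 0)) (lift_fm 1 p)"
  show ?case
  proof (rule PA_cases)
    show "PA \<turnstile> subst_fm 0 Zero (Var 0 \<^bold>\<le> num_trm (Suc n) \<^bold>\<longrightarrow> p)"
      using derives_empty[OF imp_const[OF provable[OF Suc.prems[of 0]]]] by simp
    have "PA \<turnstile> Forall (Var 0 \<^bold>\<le> num_trm n \<^bold>\<longrightarrow> ?p)"
      using Suc.prems by (intro Suc.IH) (simp add: subst_num_Succ del: num_trm.simps One_nat_def)
    moreover have "PA \<turnstile> (Var 0 \<^bold>\<le> num_trm n \<^bold>\<longrightarrow> ?p) \<^bold>\<longrightarrow>
        Succ (Var 0) \<^bold>\<le> Succ (num_trm n) \<^bold>\<longrightarrow> ?p"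
      by (intro PA_imp_intro imp_intro)
        (rule detach[OF hyps(2) detach[OF provable[OF Succ_le_SuccD] hyps(1)]])
    ultimately show "PA \<turnstile> Forall (subst_fm 0 (Succ (Var 0)) (lift_fm 1 (Var 0 \<^bold>\<le> num_trm (Suc n) \<^bold>\<longrightarrow> p)))"
      using MP[OF PA_all_mono] by (simp add: lift_leq)
  qed
qed

text \<open>Shifting p along the successor \<open>n\<close> times builds the dichotomy between x < n
  and n \<le> x into the proof, without stating it as a formula of PA.\<close>

lemma PA_split:
  assumes "\<And>i. i < n \<Longrightarrow> PA \<turnstile> subst_fm 0 (num_trm i) p"
    and "PA \<turnstile> num_trm n \<^bold>\<le> Var 0 \<^bold>\<longrightarrow> p" "closed_fm 1 p"
  shows "PA \<turnstile> Forall p"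
  using assms
proof (induction n arbitrary: p)
  case 0
  show ?case
    by (rule Gen, rule MP[OF 0(2)]) (simp add: Zero_le)
next
  case (Suc n)
  let ?p = "subst_fm 0 (Succ (Var 0)) (lift_fm 1 p)"
  have lift: "lift_fm 1 p = p" using Suc.prems(3) by (rule closed_lift_fm)
  show ?case
  proof (rule PA_cases)
    show "PA \<turnstile> subst_fm 0 Zero p" using Suc.prems(1)[of 0] by simp
    show "PA \<turnstile> Forall ?p"
    proof (rule Suc.IH)
      show "PA \<turnstile> subst_fm 0 (num_trm i) ?p" if "i < n" for i
        using Suc.prems(1)[of "Suc i"] that by (simp add: subst_num_Succ del: num_trm.simps One_nat_def)
      \<comment> \<open>This is the hypothesis on the tail, instantiated at x + 1; cancelling the
        successors on both sides of the order leaves the bound \<open>n\<close>.\<close>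
      have "PA \<turnstile> Succ (num_trm n) \<^bold>\<le> Succ (Var 0) \<^bold>\<longrightarrow> ?p"
        using PA_subst[OF Suc.prems(2), of "Succ (Var 0)"] by (simp only: lift) simp
      then show "PA \<turnstile> num_trm n \<^bold>\<le> Var 0 \<^bold>\<longrightarrow> ?p"
        by (intro PA_imp_intro)
          (rule detach[OF provable detach[OF provable[OF Succ_le_SuccI] hyps(1)]])
      show "closed_fm 1 ?p"
        unfolding lift by (rule closed_subst_closed_fm[OF closed_fm_mono[OF Suc.prems(3)]]) simp_all
    qed
  qed
qed

section \<open>Evaluation of closed terms and of relativized sentences\<close>

lemma closed_term_eval: "closed_trm 0 t \<Longrightarrow> H \<tturnstile> t \<^bold>= num_trm (val e t)"
proof (induction t)
  case (Add s t)
  have "H \<tturnstile> Add (num_trm m) (num_trm n) \<^bold>= num_trm (m + n)" for m n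
    by (rule numeral_Add)
  with Add show ?case by (auto intro: eq_trans eq_Add)
next
  case (Mul s t)
  have "H \<tturnstile> Mul (num_trm m) (num_trm n) \<^bold>= num_trm (m * n)" for m n
  proof (induction n)
    case (Suc n)
    have "H \<tturnstile> Add (num_trm (m * n)) (num_trm m) \<^bold>= num_trm (m * n + m)"
      by (rule numeral_Add)
    with eq_trans[OF provable[OF basic_instances(11)] eq_Add[OF Suc eq_refl]]
    show ?case by (simp add: add.commute) (rule eq_trans)
  qed (simp add: provable basic_instances)
  with Mul show ?case by (auto intro: eq_trans eq_Mul)
qed (auto intro: eq_refl eq_Succ)

lemma numeral_neq: "m \<noteq> n \<Longrightarrow> PA \<turnstile> Neg (num_trm m \<^bold>= num_trm n)"
proof (rule derives_empty, induction m arbitrary: n)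
  case 0
  then obtain k where [simp]: "n = Suc k" by (cases n) auto
  have "{num_trm 0 \<^bold>= num_trm n} \<tturnstile> num_trm n \<^bold>= Zero" using eq_sym[OF hyps(1)] by simp
  then have "{num_trm 0 \<^bold>= num_trm n} \<tturnstile> Falsity"
    using neg_elim[OF provable[OF basic_instances(6)]] by auto
  then show ?case by (rule neg_intro)
next
  case (Suc m)
  show ?case
  proof (cases n)
    case 0
    then show ?thesis by (simp add: provable basic_instances)
  next
    case [simp]: (Suc k)
    have "{num_trm (Suc m) \<^bold>= num_trm n} \<tturnstile> num_trm m \<^bold>= num_trm k"
      by (rule eq_SuccD) simp
    moreover have "{num_trm (Suc m) \<^bold>= num_trm n} \<tturnstile> Neg (num_trm m \<^bold>= num_trm k)"
      using Suc.IH[of k] Suc.prems weaken by force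
    ultimately show ?thesis by (intro neg_intro) (rule neg_elim)
  qed
qed

text \<open>Existential quantifiers are restricted as well, because \<open>Ex\<close> abbreviates a
  negated \<open>Forall\<close>. The order formula inserted here is itself not relativized, whereas
  an order formula occurring in the argument is.\<close>

primrec bounded :: "trm \<Rightarrow> fm \<Rightarrow> fm" where
  "bounded w (s \<^bold>= t) = (s \<^bold>= t)"
| "bounded w Falsity = Falsity"
| "bounded w (p \<^bold>\<longrightarrow> q) = (bounded w p \<^bold>\<longrightarrow> bounded w q)"
| "bounded w (Forall p) = Forall (Var 0 \<^bold>\<le> lift_trm 0 w \<^bold>\<longrightarrow> bounded (lift_trm 0 w) p)"

lemma subst_bounded: "subst_fm k s (bounded w p) = bounded (subst_trm k s w) (subst_fm k s p)"
  by (induction p arbitrary: k s w) simp_all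

lemma closed_bounded: "closed_trm k w \<Longrightarrow> closed_fm k p \<Longrightarrow> closed_fm k (bounded w p)"
  by (induction p arbitrary: k w) simp_all

text \<open>As an induction measure this is invariant under substitution, so the induction
  hypothesis applies to the numeral instances of a quantified formula.\<close>

primrec depth :: "fm \<Rightarrow> nat" where
  "depth (s \<^bold>= t) = 0"
| "depth Falsity = 0"
| "depth (p \<^bold>\<longrightarrow> q) = Suc (depth p + depth q)"
| "depth (Forall p) = Suc (depth p)"

lemma depth_subst [simp]: "depth (subst_fm k s p) = depth p"
  by (induction p arbitrary: k s) simp_all

text \<open>With a numeral as bound, a universal quantifier amounts to finitely many instances:
  \<open>PA_all_below\<close> collects them if all are true, and a false one gives a
  refutation.\<close>

lemma PA_decides_bounded:
  assumes "closed_fm 0 p"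
  shows "if sat e (bounded (num_trm w) p) then PA \<turnstile> bounded (num_trm w) p
    else PA \<turnstile> Neg (bounded (num_trm w) p)"
  using assms
proof (induction p arbitrary: e rule: measure_induct_rule[of depth])
  case (less p)
  show ?case
  proof (cases p)
    case (Eq s t)
    then have s: "\<And>H. H \<tturnstile> s \<^bold>= num_trm (val e s)" and t: "\<And>H. H \<tturnstile> t \<^bold>= num_trm (val e t)"
      using less.prems by (auto intro: closed_term_eval)
    show ?thesis
    proof (cases "val e s = val e t")
      case True
      with s eq_sym[OF t] have "PA \<turnstile> s \<^bold>= t" by (metis derives_empty eq_trans)
      then show ?thesis using True Eq by simp
    next
      case False
      have "{s \<^bold>= t} \<tturnstile> num_trm (val e s) \<^bold>= num_trm (val e t)"
        by (rule eq_trans[OF eq_sym[OF s] eq_trans[OF hyps(1) t]])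
      with neg_elim[OF provable[OF numeral_neq[OF False]]] have "PA \<turnstile> Neg (s \<^bold>= t)"
        by (blast intro: derives_empty neg_intro)
      then show ?thesis using False Eq by simp
    qed
  next
    case Falsity
    have "PA \<turnstile> Neg Falsity" unfolding Neg_def by (rule derives_empty[OF imp_refl])
    then show ?thesis using Falsity by simp
  next
    case (Imp q r)
    let ?b = "bounded (num_trm w)"
    have q: "if sat e (?b q) then PA \<turnstile> ?b q else PA \<turnstile> Neg (?b q)"
      and r: "if sat e (?b r) then PA \<turnstile> ?b r else PA \<turnstile> Neg (?b r)"
      using less.prems Imp less.IH[of q e] less.IH[of r e] by simp_all
    consider "\<not> sat e (?b q)" | "sat e (?b r)" | "sat e (?b q)" "\<not> sat e (?b r)" by blast
    then show ?thesis
    proof cases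
      case 1
      with q have "PA \<turnstile> Neg (?b q)" by simp
      from neg_elim[OF provable[OF this] hyps(1)] have "{?b q} \<tturnstile> ?b r" .
      then show ?thesis using 1 Imp by (simp add: PA_imp_intro)
    next
      case 2
      with r have "PA \<turnstile> ?b r" by simp
      then have "PA \<turnstile> ?b q \<^bold>\<longrightarrow> ?b r" by (rule derives_empty[OF imp_const[OF provable]])
      then show ?thesis using 2 Imp by simp
    next
      case 3
      with q r have "PA \<turnstile> ?b q" "PA \<turnstile> Neg (?b r)" by simp_all
      then have "{?b q \<^bold>\<longrightarrow> ?b r} \<tturnstile> Falsity"
        using neg_elim[OF provable detach[OF hyps(1) provable]] by blast
      then have "PA \<turnstile> Neg (?b q \<^bold>\<longrightarrow> ?b r)" by (intro derives_empty neg_intro)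
      then show ?thesis using 3 Imp by simp
    qed
  next
    case (Forall q)
    let ?q = "\<lambda>i. bounded (num_trm w) (subst_fm 0 (num_trm i) q)"
    have IH: "if sat e (?q i) then PA \<turnstile> ?q i else PA \<turnstile> Neg (?q i)" for i
      using less.prems Forall less.IH[of "subst_fm 0 (num_trm i) q" e]
      by (simp add: closed_subst_closed_fm)
    have sub: "?q i = subst_fm 0 (num_trm i) (bounded (num_trm w) q)" for i
      by (simp add: subst_bounded)
    have sat: "sat e (bounded (num_trm w) p) \<longleftrightarrow> (\<forall>i\<le>w. sat e (?q i))"
      unfolding Forall sub by (simp add: sat_subst ins_0)
    show ?thesis
    proof (cases "\<forall>i\<le>w. sat e (?q i)")
      case True
      then have "PA \<turnstile> ?q i" if "i \<le> w" for i using IH[of i] that by simp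
      from this[unfolded sub] have "PA \<turnstile> bounded (num_trm w) p"
        unfolding Forall bounded.simps lift_num by (rule PA_all_below)
      then show ?thesis using True sat by simp
    next
      case False
      then obtain i where "i \<le> w" "\<not> sat e (?q i)" by blast
      with IH[of i] have i: "i \<le> w" "PA \<turnstile> Neg (?q i)" by simp_all
      have "{bounded (num_trm w) p} \<tturnstile> subst_fm 0 (num_trm i) (Var 0 \<^bold>\<le> num_trm w \<^bold>\<longrightarrow> bounded (num_trm w) q)"
        unfolding Forall by (rule all_elim) simp
      then have "{bounded (num_trm w) p} \<tturnstile> num_trm i \<^bold>\<le> num_trm w \<^bold>\<longrightarrow> ?q i"
        unfolding sub by simp
      from neg_elim[OF provable[OF i(2)] detach[OF this numeral_le[OF i(1)]]]
      have "PA \<turnstile> Neg (bounded (num_trm w) p)" by (intro derives_empty neg_intro)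
      then show ?thesis using False sat by auto
    qed
  qed
qed

section \<open>Positive formulas\<close>

text \<open>\<open>positive b m\<close>: only variables with index below \<open>m\<close> are free, and only those below \<open>b\<close> serve
  as bounds of universal quantifiers.  The latter restriction makes the relativization to the
  numbers up to \<open>w\<close> harmless: bounds are existentially quantified, hence at most \<open>w\<close>.\<close>

inductive positive :: "nat \<Rightarrow> nat \<Rightarrow> fm \<Rightarrow> bool" where
  positive_Eq: "closed_trm m s \<Longrightarrow> closed_trm m t \<Longrightarrow> positive b m (s \<^bold>= t)"
| positive_Falsity: "positive b m Falsity"
| positive_And: "positive b m p \<Longrightarrow> positive b m q \<Longrightarrow> positive b m (p \<^bold>\<and> q)"
| positive_Or: "positive b m p \<Longrightarrow> positive b m q \<Longrightarrow> positive b m (p \<^bold>\<or> q)"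
| positive_Ex: "positive (Suc b) (Suc m) p \<Longrightarrow> positive b m (Ex p)"
| positive_all: "k < b \<Longrightarrow> k < m \<Longrightarrow> positive (Suc b) (Suc m) p \<Longrightarrow>
    positive b m (Forall (Var 0 \<^bold>\<le> Var (Suc k) \<^bold>\<longrightarrow> p))"

lemma positive_closed: "positive b m p \<Longrightarrow> closed_fm m p"
  by (induction rule: positive.induct) simp_all

lemma sat_bounded_simps [simp]:
  "sat e (bounded w (Neg p)) \<longleftrightarrow> \<not> sat e (bounded w p)"
  "sat e (bounded w (p \<^bold>\<and> q)) \<longleftrightarrow> sat e (bounded w p) \<and> sat e (bounded w q)"
  "sat e (bounded w (p \<^bold>\<or> q)) \<longleftrightarrow> sat e (bounded w p) \<or> sat e (bounded w q)"
  "sat e (bounded w (Ex p)) \<longleftrightarrow> (\<exists>x\<le>val e w. sat (case_nat x e) (bounded (lift_trm 0 w) p))"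
  by (auto simp: Neg_def And_def Or_def Ex_def)

text \<open>The order formula has the difference as its existential witness, and the relativization
  forces this witness below the bound as well.\<close>

lemma sat_bounded_leq [simp]:
  "sat e (bounded w (s \<^bold>\<le> t)) \<longleftrightarrow> val e s \<le> val e t \<and> val e t \<le> val e s + val e w"
  by (auto simp: leq_fm_eq intro!: exI[of _ "val e t - val e s"])

text \<open>The condition on \<open>e\<close> keeps all admissible bounds at most \<open>w\<close>.
  It survives both quantifiers, since witnesses are at most \<open>w\<close> and a universally
  quantified number is at most one of these bounds.\<close>

lemma positive_bounded_imp_sat:
  "positive b m p \<Longrightarrow> \<forall>i<b. e i \<le> w \<Longrightarrow> sat e (bounded (num_trm w) p) \<Longrightarrow> sat e p"
proof (induction arbitrary: e rule: positive.induct)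
  case (positive_Ex b m p)
  then obtain x where "x \<le> w" "sat (case_nat x e) (bounded (num_trm w) p)" by auto
  moreover have "\<forall>i<Suc b. case_nat x e i \<le> w"
    using positive_Ex.prems \<open>x \<le> w\<close> by (simp split: nat.split)
  ultimately show ?case using positive_Ex.IH by auto
next
  case (positive_all k b m p)
  show ?case
    unfolding sat.simps
  proof (intro allI impI)
    fix x assume "sat (case_nat x e) (Var 0 \<^bold>\<le> Var (Suc k))"
    then have x: "x \<le> e k" "e k \<le> w" using positive_all by auto
    then have "\<forall>i<Suc b. case_nat x e i \<le> w"
      using positive_all.prems by (simp split: nat.split)
    \<comment> \<open>From x \<le> e k \<le> w it follows that x lies in the relativized range and
      that the difference hidden in the order formula is at most w. Hence the premise remains true
      after relativization.\<close>
    moreover have "sat (case_nat x e) (bounded (num_trm w) p)"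
      using positive_all.prems x by simp
    ultimately show "sat (case_nat x e) p" using positive_all.IH by blast
  qed
qed auto

text \<open>Arguing with all sufficiently large \<open>w\<close> replaces a monotonicity argument: a
  fixed existential witness is eventually below \<open>w\<close>, and a bounded universal quantifier
  imposes only finitely many eventual conditions.\<close>

lemma positive_sat_imp_bounded:
  "positive b m p \<Longrightarrow> sat e p \<Longrightarrow> \<forall>\<^sub>F w in sequentially. sat e (bounded (num_trm w) p)"
proof (induction arbitrary: e rule: positive.induct)
  case (positive_And b m p q)
  then show ?case by (simp add: eventually_conj_iff)
next
  case (positive_Or b m p q)
  from \<open>sat e (p \<^bold>\<or> q)\<close> have "sat e p \<or> sat e q" by simp
  then show ?case
  proof
    assume "sat e p"
    from positive_Or.IH(1)[OF this] show ?thesis by (rule eventually_mono) simp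
  next
    assume "sat e q"
    from positive_Or.IH(2)[OF this] show ?thesis by (rule eventually_mono) simp
  qed
next
  case (positive_Ex b m p)
  then obtain x where "sat (case_nat x e) p" by auto
  from eventually_conj[OF positive_Ex.IH[OF this] eventually_ge_at_top[of x]]
  show ?case by (rule eventually_mono) (simp, blast)
next
  case (positive_all k b m p)
  have "\<forall>x\<in>{..e k}. \<forall>\<^sub>F w in sequentially. sat (case_nat x e) (bounded (num_trm w) p)"
    using positive_all by simp
  then have "\<forall>\<^sub>F w in sequentially. \<forall>x\<in>{..e k}. sat (case_nat x e) (bounded (num_trm w) p)"
    by (intro eventually_ball_finite) auto
  then show ?case by (rule eventually_mono) simp
qed simp_all

lemma positive_sat_iff:
  assumes "positive 0 m p"
  shows "sat e p \<longleftrightarrow> (\<exists>w. sat e (bounded (num_trm w) p))"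
proof
  assume "sat e p"
  from eventually_happens'[OF sequentially_bot positive_sat_imp_bounded[OF assms this]]
  show "\<exists>w. sat e (bounded (num_trm w) p)" .
next
  assume "\<exists>w. sat e (bounded (num_trm w) p)"
  then show "sat e p" using positive_bounded_imp_sat[OF assms] by auto
qed


section \<open>Rosser sentences\<close>

text \<open>Under the outer quantifier, index 0 is the bound witnessing \<open>p\<close> and index 1
  the parameter. Under the inner one, index 0 is a competing bound for \<open>q\<close>, index 1 the
  bound for \<open>p\<close> and index 2 the parameter.\<close>

definition rosser :: "fm \<Rightarrow> fm \<Rightarrow> fm" where
  "rosser p q = Ex (bounded (Var 0) (subst_fm 0 (Var 1) p) \<^bold>\<and>
     Forall (Var 0 \<^bold>\<le> Var 1 \<^bold>\<longrightarrow> Neg (bounded (Var 0) (subst_fm 0 (Var 2) q))))"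

lemma closed_fm_subst_Var: "closed_fm 1 p \<Longrightarrow> i \<le> k \<Longrightarrow> closed_fm (Suc k) (subst_fm 0 (Var i) p)"
  using closed_fm_mono[of 1 p "Suc (Suc k)"] by (simp add: closed_subst_closed_fm)

lemma closed_rosser: "closed_fm 1 p \<Longrightarrow> closed_fm 1 q \<Longrightarrow> closed_fm 1 (rosser p q)"
  by (simp add: rosser_def closed_bounded closed_fm_subst_Var)

text \<open>PA decides each comparison with a numeral bound, so the least bound witnessing either
  side settles the sentence; a tie counts in favour of \<open>q\<close>.\<close>

theorem rosser_decided:
  assumes p: "positive 0 1 p" and q: "positive 0 1 q"
    and sat: "sat (case_nat c e) p \<or> sat (case_nat c e) q"
  defines "A \<equiv> subst_fm 0 (num_trm c) (rosser p q)"
  shows "PA \<turnstile> A \<and> sat (case_nat c e) p \<or> PA \<turnstile> Neg A \<and> sat (case_nat c e) q"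
proof -
  define p' q' where "p' = subst_fm 0 (num_trm c) p" and "q' = subst_fm 0 (num_trm c) q"
  note closed = positive_closed[OF p] positive_closed[OF q]
  have closed': "closed_fm 0 p'" "closed_fm 0 q'"
    using closed unfolding p'_def q'_def by (auto intro: closed_subst_closed_fm)
  define R where "R = (bounded (Var 0) p' \<^bold>\<and> Forall (Var 0 \<^bold>\<le> Var 1 \<^bold>\<longrightarrow> Neg (bounded (Var 0) q')))"
  have A: "A = Ex R"
    using closed by (simp add: A_def R_def rosser_def subst_bounded subst_subst_fm p'_def q'_def)
  have sub: "subst_fm k (num_trm w) p' = p'" "subst_fm k (num_trm w) q' = q'" for k w
    using closed_fm_mono[OF closed'(1), of k] closed_fm_mono[OF closed'(2), of k]
    by (auto intro: closed_subst_fm)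
  have R: "subst_fm 0 (num_trm w) R = (bounded (num_trm w) p' \<^bold>\<and>
      Forall (Var 0 \<^bold>\<le> num_trm w \<^bold>\<longrightarrow> Neg (bounded (Var 0) q')))" for w
    by (simp add: R_def subst_bounded sub)
  have R_closed: "closed_fm 1 R"
    using closed' closed_fm_mono[of 0 _ "Suc 0"] closed_fm_mono[of 0 _ "Suc (Suc 0)"]
    by (simp add: R_def closed_bounded)
  let ?P = "\<lambda>w. sat e (bounded (num_trm w) p')" and ?Q = "\<lambda>w. sat e (bounded (num_trm w) q')"
  have sat_p: "sat (case_nat c e) p \<longleftrightarrow> (\<exists>w. ?P w)" and sat_q: "sat (case_nat c e) q \<longleftrightarrow> (\<exists>w. ?Q w)"
    using subst_bounded[of 0 "num_trm c" "num_trm _", simplified]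
    by (simp_all add: p'_def q'_def positive_sat_iff[OF p] positive_sat_iff[OF q]
      sat_subst ins_0 flip: subst_bounded[of 0 "num_trm c" "num_trm _", simplified])
  have P: "PA \<turnstile> bounded (num_trm w) p'" if "?P w" for w
    using PA_decides_bounded[OF closed'(1)] that by presburger
  have nP: "PA \<turnstile> Neg (bounded (num_trm w) p')" if "\<not> ?P w" for w
    using PA_decides_bounded[OF closed'(1)] that by presburger
  have Q: "PA \<turnstile> bounded (num_trm w) q'" if "?Q w" for w
    using PA_decides_bounded[OF closed'(2)] that by presburger
  have nQ: "PA \<turnstile> Neg (bounded (num_trm w) q')" if "\<not> ?Q w" for w
    using PA_decides_bounded[OF closed'(2)] that by presburger
  \<comment> \<open>Some bound qualifies because a true positive formula remains true when
    relativized to a suitable bound.\<close>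
  define w where "w = (LEAST w. ?P w \<or> ?Q w)"
  have w: "?P w \<or> ?Q w" using sat sat_p sat_q unfolding w_def by (metis (lifting) LeastI)
  have below: "\<not> ?P i" "\<not> ?Q i" if "i < w" for i
    using that not_less_Least unfolding w_def by blast+
  show ?thesis
  proof (cases "?Q w")
    case True
    \<comment> \<open>Below \<open>w\<close> the first conjunct of \<open>R\<close> fails at each
      numeral. From \<open>w\<close> on, the second conjunct would deny that \<open>w\<close>
      witnesses \<open>q'\<close>.\<close>
    have "PA \<turnstile> Forall (Neg R)"
    proof (rule PA_split)
      show "closed_fm 1 (Neg R)" using R_closed by simp
      fix i assume "i < w"
      have "{subst_fm 0 (num_trm i) R} \<tturnstile> bounded (num_trm i) p'"
        unfolding R by (rule and_elim1[OF hyps(1)])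
      from neg_elim[OF provable[OF nP[OF below(1)[OF \<open>i < w\<close>]]] this]
      show "PA \<turnstile> subst_fm 0 (num_trm i) (Neg R)"
        unfolding subst_connectives by (intro derives_empty neg_intro)
    next
      let ?H = "{R, num_trm w \<^bold>\<le> Var 0}"
      have "?H \<tturnstile> Forall (Var 0 \<^bold>\<le> Var 1 \<^bold>\<longrightarrow> Neg (bounded (Var 0) q'))"
        unfolding R_def by (rule and_elim2[OF hyps(1)])
      then have "?H \<tturnstile> subst_fm 0 (num_trm w) (Var 0 \<^bold>\<le> Var 1 \<^bold>\<longrightarrow> Neg (bounded (Var 0) q'))"
        by (rule all_elim)
      then have "?H \<tturnstile> num_trm w \<^bold>\<le> Var 0 \<^bold>\<longrightarrow> Neg (bounded (num_trm w) q')"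
        by (simp add: subst_bounded sub)
      from neg_elim[OF detach[OF this hyps(2)] provable[OF Q[OF True]]]
      show "PA \<turnstile> num_trm w \<^bold>\<le> Var 0 \<^bold>\<longrightarrow> Neg R"
        by (intro PA_imp_intro neg_intro)
    qed
    then have "{Ex R} \<tturnstile> Falsity"
      unfolding Ex_def by (intro neg_elim[OF hyps(1) provable])
    then have "PA \<turnstile> Neg A" unfolding A by (intro derives_empty neg_intro)
    then show ?thesis using True sat_q by blast
  next
    case False
    \<comment> \<open>Now \<open>w\<close> witnesses \<open>p'\<close> and nothing up to
      \<open>w\<close> witnesses \<open>q'\<close>, so the numeral of \<open>w\<close> is the
      witness for \<open>Ex R\<close>.\<close>
    then have "\<not> ?Q i" if "i \<le> w" for i using that below(2)[of i] by (cases "i = w") auto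
    from nQ[OF this] have "PA \<turnstile> Forall (Var 0 \<^bold>\<le> num_trm w \<^bold>\<longrightarrow> Neg (bounded (Var 0) q'))"
      by (intro PA_all_below) (simp add: subst_bounded sub)
    then have "{} \<tturnstile> subst_fm 0 (num_trm w) R"
      unfolding R using P w False by (intro and_intro provable) auto
    then have "PA \<turnstile> A" unfolding A by (intro derives_empty ex_intro)
    then show ?thesis using w False sat_p by blast
  qed
qed


section \<open>Positivity of the arithmetized syntax\<close>

lemma closed_term_constructors [simp]:
  "closed_trm k \<langle>s, t\<rangle> \<longleftrightarrow> closed_trm k s \<and> closed_trm k t"
  "closed_trm k \<lceil>p\<rceil>" "closed_trm k (quote_trm t)" "closed_trm k tZero" "closed_trm k tFalsity"
  "closed_trm k (tVar t) \<longleftrightarrow> closed_trm k t" "closed_trm k (tSucc t) \<longleftrightarrow> closed_trm k t"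
  "closed_trm k (tAdd s t) \<longleftrightarrow> closed_trm k s \<and> closed_trm k t"
  "closed_trm k (tMul s t) \<longleftrightarrow> closed_trm k s \<and> closed_trm k t"
  "closed_trm k (tEq s t) \<longleftrightarrow> closed_trm k s \<and> closed_trm k t"
  "closed_trm k (tImp s t) \<longleftrightarrow> closed_trm k s \<and> closed_trm k t"
  "closed_trm k (tForall t) \<longleftrightarrow> closed_trm k t"
  unfolding quote_fm_def quote_trm_def tZero_def tFalsity_def tVar_def tSucc_def tAdd_def tMul_def
    tEq_def tImp_def tForall_def by (auto simp: tpair_def simp del: num_trm.simps)

lemma subst_pair [simp]: "subst_trm k s \<langle>t, u\<rangle> = \<langle>subst_trm k s t, subst_trm k s u\<rangle>"
  by (simp add: tpair_def)

lemma lift_quote [simp]: "lift_trm k \<lceil>p\<rceil> = \<lceil>p\<rceil>"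
  by (simp add: closed_lift_trm)

lemma subst_quote [simp]: "subst_trm k s \<lceil>p\<rceil> = \<lceil>p\<rceil>"
  by (simp add: closed_subst_trm)

text \<open>Positivity of the concrete arithmetizations thereby becomes a syntax check done by
  simplification.\<close>

lemmas [simp] = positive.intros

lemma positive_disj [simp]: "\<forall>p\<in>set ps. positive b m p \<Longrightarrow> positive b m (disj ps)"
  by (induction ps) (simp_all add: disj_def)

lemma positive_leq [simp]:
  "closed_trm m s \<Longrightarrow> closed_trm m t \<Longrightarrow> positive b m (s \<^bold>\<le> t)"
  "closed_trm m s \<Longrightarrow> closed_trm m t \<Longrightarrow> positive b m (s \<^bold>< t)"
  by (simp_all add: less_fm_def leq_fm_eq)

lemma positive_beta [simp]:
  "closed_trm m a \<Longrightarrow> closed_trm m b \<Longrightarrow> closed_trm m i \<Longrightarrow> closed_trm m z \<Longrightarrow>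
    positive k m (beta_fm a b i z)"
  by (simp add: beta_fm_def ex_defs)

lemma positive_before [simp]:
  "closed_trm m a \<Longrightarrow> closed_trm m b \<Longrightarrow> closed_trm m i \<Longrightarrow> closed_trm m z \<Longrightarrow>
    positive k m (before a b i z)"
  by (simp add: before_def ex_defs)

text \<open>Since \<open>k\<close> may be 0, a step formula must not use any variable of its
  arguments to bound a universal quantifier.\<close>

definition positive_step :: "(trm \<Rightarrow> trm \<Rightarrow> trm \<Rightarrow> trm \<Rightarrow> fm) \<Rightarrow> bool" where
  "positive_step step \<longleftrightarrow> (\<forall>k m a b i z. closed_trm m a \<longrightarrow> closed_trm m b \<longrightarrow>
     closed_trm m i \<longrightarrow> closed_trm m z \<longrightarrow> positive k m (step a b i z))"

lemma positive_constr_seq [simp]: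
  "positive_step step \<Longrightarrow> closed_trm m a \<Longrightarrow> closed_trm m b \<Longrightarrow> n < k \<Longrightarrow> n < m \<Longrightarrow>
    positive k m (constr_seq step a b (Var n))"
  by (simp add: constr_seq_def all_leq_def ex_defs numeral_2_eq_2 positive_step_def)

text \<open>The universal quantifier over positions is bounded by the last position, which is
  existentially quantified here and therefore admissible as a bound for every
  \<open>k\<close>.\<close>

lemma positive_constructible [simp]:
  "positive_step step \<Longrightarrow> closed_trm m x \<Longrightarrow> positive k m (constructible step x)"
  by (simp add: constructible_def ex_defs numeral_3_eq_3)

lemma positive_step_trm: "positive_step is_trm_step"
  by (simp add: positive_step_def is_trm_step_def ex_defs numeral_eq_Suc)

lemma positive_is_trm [simp]: "closed_trm m x \<Longrightarrow> positive k m (is_trm_fm x)"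
  by (simp add: is_trm_fm_def positive_step_trm)

lemma positive_step_fm: "positive_step is_fm_step"
  by (simp add: positive_step_def is_fm_step_def ex_defs numeral_eq_Suc)

lemma positive_is_fm [simp]: "closed_trm m x \<Longrightarrow> positive k m (is_fm_fm x)"
  by (simp add: is_fm_fm_def positive_step_fm)

lemma positive_step_lift: "positive_step lift_step"
  by (simp add: positive_step_def lift_step_def ex_defs numeral_eq_Suc)

lemma positive_lift_graph [simp]:
  "closed_trm m t \<Longrightarrow> closed_trm m x \<Longrightarrow> closed_trm m y \<Longrightarrow> positive k m (lift_graph t x y)"
  by (simp add: lift_graph_def positive_step_lift)

lemma positive_step_subst: "positive_step subst_step"
  by (simp add: positive_step_def subst_step_def ex_defs numeral_eq_Suc)

lemma positive_subst_graph [simp]: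
  "closed_trm m t \<Longrightarrow> closed_trm m s \<Longrightarrow> closed_trm m x \<Longrightarrow> closed_trm m y \<Longrightarrow>
    positive k m (subst_graph t s x y)"
  by (simp add: subst_graph_def positive_step_subst)

lemma positive_step_num: "positive_step num_step"
  by (simp add: positive_step_def num_step_def ex_defs numeral_eq_Suc)

lemma positive_num_graph [simp]:
  "closed_trm m x \<Longrightarrow> closed_trm m y \<Longrightarrow> positive k m (num_graph x y)"
  by (simp add: num_graph_def positive_step_num)

lemma positive_axiom [simp]: "closed_trm m z \<Longrightarrow> positive k m (axiom_fm z)"
  by (simp add: axiom_fm_def ex_defs numeral_eq_Suc)

lemma positive_step_proof: "positive_step proof_step"
  by (simp add: positive_step_def proof_step_def ex_defs)

lemma positive_Prf [simp]: "closed_trm m x \<Longrightarrow> closed_trm m y \<Longrightarrow> positive k m (Prf x y)"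
  by (simp add: Prf_def ex_defs numeral_eq_Suc positive_step_proof)

lemma positive_Prov [simp]: "closed_trm m x \<Longrightarrow> positive k m (Prov x)"
  by (simp add: Prov_def ex_defs)

section \<open>Substitution into the arithmetized predicates\<close>

lemma subst_beta [simp]: "subst_fm k s (beta_fm a b i z) =
    beta_fm (subst_trm k s a) (subst_trm k s b) (subst_trm k s i) (subst_trm k s z)"
  by (simp add: beta_fm_def ex_defs)

text \<open>Positivity also bounds the free variables: only the three innermost indices occur, so a
  substitution beyond them changes nothing.\<close>

lemma subst_constr_seq:
  "positive_step step \<Longrightarrow> subst_fm (Suc (Suc (Suc k))) s (constr_seq step (Var 2) (Var (Suc 0)) (Var 0)) =
    constr_seq step (Var 2) (Var (Suc 0)) (Var 0)"
  by (intro closed_subst_fm closed_fm_mono[OF positive_closed[of 3 3]]) simp_all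

lemma subst_constructible:
  "positive_step step \<Longrightarrow> subst_fm k s (constructible step x) = constructible step (subst_trm k s x)"
  by (simp add: constructible_def ex_defs subst_constr_seq) (simp add: numeral_eq_Suc)

lemma subst_subst_graph [simp]: "subst_fm k s (subst_graph t u x y) =
    subst_graph (subst_trm k s t) (subst_trm k s u) (subst_trm k s x) (subst_trm k s y)"
  by (simp add: subst_graph_def subst_constructible positive_step_subst)

lemma subst_num_graph [simp]:
  "subst_fm k s (num_graph x y) = num_graph (subst_trm k s x) (subst_trm k s y)"
  by (simp add: num_graph_def subst_constructible positive_step_num)

lemma subst_Prf [simp]: "subst_fm k s (Prf x y) = Prf (subst_trm k s x) (subst_trm k s y)"
  by (simp add: Prf_def ex_defs subst_constr_seq positive_step_proof) (simp add: numeral_eq_Suc)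

lemma subst_Prov [simp]: "subst_fm k s (Prov x) = Prov (subst_trm k s x)"
  by (simp add: Prov_def ex_defs)


section \<open>Arithmetization of constructive falsity\<close>

text \<open>In the two templates the variable with index 1 stands for the code of \<open>p\<close> in \<open>Box p\<close> and of \<open>A\<close>
  in the matrix of \<open>cf n A\<close>.\<close>

definition Box_template :: fm where
  "Box_template = ex2 (\<lambda>s y. num_graph (Var 2) s \<^bold>\<and> subst_graph Zero s (Var 3) y \<^bold>\<and> Prov y)"

definition nonproof_template :: fm where
  "nonproof_template = Neg (Prf (Var 0) (Var 1))"

text \<open>\<open>Box p\<close> depends on \<open>p\<close> only through the numeral of its code,
  so adding a box is a substitution into a fixed formula and can be arithmetized by
  \<open>subst_graph\<close>.\<close>

lemma subst_Box_template: "subst_fm (Suc 0) (num_trm (code_fm p)) Box_template = Box p"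
  by (simp add: Box_template_def Box_def ex_defs quote_fm_def)

lemma subst_nonproof_template:
  "subst_fm (Suc 0) (num_trm (code_fm A)) nonproof_template = Neg (Prf (Var 0) \<lceil>A\<rceil>)"
  by (simp add: nonproof_template_def quote_fm_def)

text \<open>The entries are the pairs \<open>\<langle>g, u\<rangle>\<close> where \<open>u\<close> is the code of an iterated box of the formula with
  code \<open>g\<close>; the component \<open>g\<close> is there because construction steps have no parameters.\<close>

definition box_step :: "trm \<Rightarrow> trm \<Rightarrow> trm \<Rightarrow> trm \<Rightarrow> fm" where
  "box_step a b i z = disj
    [ex1 (\<lambda>g. up 1 z \<^bold>= \<langle>g, g\<rangle>),
     ex4 (\<lambda>g u m y. before (up 4 a) (up 4 b) (up 4 i) \<langle>g, u\<rangle> \<^bold>\<and> num_graph u m \<^bold>\<and>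
       subst_graph (Succ Zero) m \<lceil>Box_template\<rceil> y \<^bold>\<and> up 4 z \<^bold>= \<langle>g, y\<rangle>)]"

definition box_iter :: "trm \<Rightarrow> trm \<Rightarrow> fm" where
  "box_iter g u = constructible box_step \<langle>g, u\<rangle>"

lemma positive_step_box: "positive_step box_step"
  by (simp add: positive_step_def box_step_def ex_defs numeral_eq_Suc)

lemma positive_box_iter [simp]:
  "closed_trm m g \<Longrightarrow> closed_trm m u \<Longrightarrow> positive k m (box_iter g u)"
  by (simp add: box_iter_def positive_step_box)

definition S_box :: "(nat \<Rightarrow> bool) \<Rightarrow> nat \<Rightarrow> bool" where
  "S_box P z \<longleftrightarrow> (\<exists>g. z = pair g g) \<or>
     (\<exists>g u. P (pair g u) \<and> z = pair g (code_fm (subst_fm (Suc 0) (num_trm u) Box_template)))"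

lemma represents_box: "represents box_step S_box"
  unfolding represents_def
proof (intro conjI allI)
  show "monoS S_box" unfolding monoS_def S_box_def by blast
next
  fix e a b i z
  \<comment> \<open>Here \<open>u\<close> may be any number, not just the code of a formula: what is
    substituted is its numeral, which is always a term.\<close>
  have "sat (case_nat y (case_nat (code_trm (num_trm u)) e')) (subst_graph (Succ Zero) (Var (Suc 0)) \<lceil>Box_template\<rceil> (Var 0))
    \<longleftrightarrow> y = code_fm (subst_fm (Suc 0) (num_trm u) Box_template)" for y u e'
    by (subst sat_subst_graph[of _ _ "num_trm u" _ Box_template]) simp_all
  then show "sat e (box_step a b i z) \<longleftrightarrow>
     S_box (\<lambda>u. \<exists>j < val e i. u = beta (val e a) (val e b) j) (val e z)"
    by (simp add: box_step_def ex_defs S_box_def)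
qed

lemma der_box: "der S_box (pair (code_fm p) (code_fm ((Box ^^ n) p)))"
proof (induction n)
  case 0
  show ?case by (rule der.intros[of "[]"]) (auto simp: S_box_def)
next
  case (Suc n)
  have "S_box (\<lambda>u. u \<in> set [pair (code_fm p) (code_fm ((Box ^^ n) p))])
      (pair (code_fm p) (code_fm ((Box ^^ Suc n) p)))"
    unfolding S_box_def using subst_Box_template by auto
  then show ?case by (rule der.intros[rotated]) (simp add: Suc)
qed

lemma sat_box_iter:
  assumes "val e g = code_fm p"
  shows "sat e (box_iter g u) \<longleftrightarrow> (\<exists>n. val e u = code_fm ((Box ^^ n) p))"
proof
  assume *: "sat e (box_iter g u)"
  \<comment> \<open>The initial construction step admits every number as first component, so the
    invariant speaks only about pairs whose first component codes a formula.\<close>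
  define R where "R z \<longleftrightarrow> (\<forall>p u. z = pair (code_fm p) u \<longrightarrow> (\<exists>n. u = code_fm ((Box ^^ n) p)))" for z
  have "R (val e \<langle>g, u\<rangle>)"
  proof (rule constructible_sound[OF represents_box])
    fix z assume "S_box R z"
    then show "R z"
      unfolding S_box_def
    proof (elim disjE exE conjE)
      fix g assume "z = pair g g"
      then show "R z" by (auto simp: R_def intro!: exI[of _ 0])
    next
      fix g u assume R: "R (pair g u)"
        and z: "z = pair g (code_fm (subst_fm (Suc 0) (num_trm u) Box_template))"
      show "R z"
        unfolding R_def
      proof (intro allI impI)
        fix p v assume "z = pair (code_fm p) v"
        then have "g = code_fm p" and v: "v = code_fm (subst_fm (Suc 0) (num_trm u) Box_template)"
          using z by simp_all
        then obtain n where "u = code_fm ((Box ^^ n) p)" using R by (auto simp: R_def)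
        then have "v = code_fm ((Box ^^ Suc n) p)" using v by (simp add: subst_Box_template)
        then show "\<exists>n. v = code_fm ((Box ^^ n) p)" ..
      qed
    qed
  qed (use * in \<open>simp add: box_iter_def\<close>)
  then show "\<exists>n. val e u = code_fm ((Box ^^ n) p)" using assms by (simp add: R_def)
next
  assume "\<exists>n. val e u = code_fm ((Box ^^ n) p)"
  then show "sat e (box_iter g u)"
    using der_box assms unfolding box_iter_def
    by (auto intro!: constructible_complete[OF represents_box])
qed

text \<open>Admitting \<open>n = 0\<close>, too, is harmless since \<open>cf 0 A\<close> also contradicts the provability of \<open>A\<close>.\<close>

definition refutable :: "fm \<Rightarrow> bool" where
  "refutable A \<longleftrightarrow> PA \<turnstile> Neg A \<or> (\<exists>n. PA \<turnstile> cf n A)"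

text \<open>The number of boxes disappears into the existential quantifiers of
  \<open>box_iter\<close>, so a single positive formula covers all \<open>n\<close> at once.\<close>

definition refutable_fm :: "trm \<Rightarrow> fm" where
  "refutable_fm a = Prov (tImp a tFalsity) \<^bold>\<or>
     ex3 (\<lambda>m g u. num_graph (up 3 a) m \<^bold>\<and> subst_graph (Succ Zero) m \<lceil>nonproof_template\<rceil> g \<^bold>\<and>
       box_iter g u \<^bold>\<and> Prov (tForall u))"

lemma positive_refutable_fm [simp]: "closed_trm m a \<Longrightarrow> positive k m (refutable_fm a)"
  by (simp add: refutable_fm_def ex_defs numeral_eq_Suc)

lemma sat_Prov_code: "val e y = code_fm p \<Longrightarrow> sat e (Prov y) \<longleftrightarrow> PA \<turnstile> p"
  by (auto simp: sat_Prov)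

lemma sat_refutable_fm:
  assumes "val e a = code_fm A"
  shows "sat e (refutable_fm a) \<longleftrightarrow> refutable A"
proof -
  let ?N = "Neg (Prf (Var 0) \<lceil>A\<rceil>)"
  let ?e = "\<lambda>m g u. case_nat u (case_nat g (case_nat m e))"
  have Neg: "sat e (Prov (tImp a tFalsity)) \<longleftrightarrow> PA \<turnstile> Neg A"
    by (rule sat_Prov_code) (simp add: assms Neg_def)
  have N: "sat (?e (code_trm (num_trm (code_fm A))) g u) (subst_graph (Succ Zero) (Var 2) \<lceil>nonproof_template\<rceil> (Var (Suc 0)))
      \<longleftrightarrow> g = code_fm ?N" for g u
    by (subst sat_subst_graph[of _ _ "num_trm (code_fm A)" _ nonproof_template])
      (simp_all add: subst_nonproof_template)
  have box: "sat (?e m (code_fm ?N) u) (box_iter (Var (Suc 0)) (Var 0)) \<longleftrightarrow>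
      (\<exists>n. u = code_fm ((Box ^^ n) ?N))" for m u
    by (subst sat_box_iter[of _ _ ?N]) simp_all
  have Prov: "sat (?e m g (code_fm ((Box ^^ n) ?N))) (Prov (tForall (Var 0))) \<longleftrightarrow> PA \<turnstile> cf n A" for m g n
    by (rule sat_Prov_code) (simp add: cf_def)
  show ?thesis
    unfolding refutable_fm_def refutable_def sat_connectives Neg ex_defs
    by (auto simp: assms N box Prov)
qed

text \<open>Let x code an actual proof of \<open>A\<close>. The matrix of \<open>cf 0 A\<close> is
  false at x, and soundness keeps every iterated box false there: a true box would make the formula
  under it provable, hence true, at x.\<close>

lemma provable_not_refutable:
  assumes "PA \<turnstile> A" shows "\<not> refutable A"
proof -
  obtain ps where ps: "is_proof ps" "ps \<noteq> []" "last ps = A"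
    using assms unfolding PA_proves_iff by blast
  obtain x where x: "codes_list x ps" using codes_list_ex[OF ps(2)] by blast
  have *: "\<not> sat e ((Box ^^ n) (Neg (Prf (Var 0) \<lceil>A\<rceil>)))" if "e 0 = x" for n e
    using that
  proof (induction n arbitrary: e)
    case 0
    then show ?case using ps x by (auto simp: sat_Prf)
  next
    case (Suc n)
    have "\<not> PA \<turnstile> subst_fm 0 (num_trm x) ((Box ^^ n) (Neg (Prf (Var 0) \<lceil>A\<rceil>)))"
    proof
      assume "PA \<turnstile> subst_fm 0 (num_trm x) ((Box ^^ n) (Neg (Prf (Var 0) \<lceil>A\<rceil>)))"
      from PA_sound[OF this, of e] show False
        using Suc.IH[of "case_nat x e"] by (simp add: sat_subst ins_0)
    qed
    then show ?case using Suc.prems by (simp add: sat_Box)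
  qed
  have "\<not> PA \<turnstile> cf n A" for n
    using *[of "case_nat x (\<lambda>_. 0)"] PA_sound[of "cf n A" "\<lambda>_. 0"] by (auto simp: cf_def)
  moreover have "\<not> PA \<turnstile> Neg A"
    using PA_sound[OF assms] PA_sound[of "Neg A"] by auto
  ultimately show ?thesis by (simp add: refutable_def)
qed

text \<open>The free variable is both the code of a formula and the number whose numeral is
  substituted into that formula. With self-application built in, evaluation in the standard model
  takes the place of a provable fixed-point equivalence.\<close>

definition diagonal_fm :: "(trm \<Rightarrow> fm) \<Rightarrow> fm" where
  "diagonal_fm f = ex2 (\<lambda>s a. num_graph (Var 2) s \<^bold>\<and> subst_graph Zero s (Var 2) a \<^bold>\<and> f a)"

lemma sat_diagonal_fm:
  "sat (case_nat (code_fm p) e) (diagonal_fm f) \<longleftrightarrow>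
    sat (case_nat (code_fm (subst_fm 0 (num_trm (code_fm p)) p))
      (case_nat (code_trm (num_trm (code_fm p))) (case_nat (code_fm p) e))) (f (Var 0))"
proof -
  have "sat (case_nat a (case_nat (code_trm (num_trm (code_fm p))) (case_nat (code_fm p) e)))
      (subst_graph Zero (Var (Suc 0)) (Var 2) (Var 0)) \<longleftrightarrow>
      a = code_fm (subst_fm 0 (num_trm (code_fm p)) p)" for a
    by (subst sat_subst_graph[of _ _ "num_trm (code_fm p)" _ p]) simp_all
  then show ?thesis by (simp add: diagonal_fm_def ex_defs)
qed

theorem theorem4p6:
  shows "\<exists>A. sentence A \<and> extremely_independent A"
proof -
  \<comment> \<open>At the code of \<open>rosser p q\<close>, these will express that
    \<open>A\<close> and \<open>Neg A\<close>, respectively, are refutable; negation is implication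
    to falsity also on codes.\<close>
  define p q where "p = diagonal_fm refutable_fm"
    and "q = diagonal_fm (\<lambda>a. refutable_fm (tImp a tFalsity))"
  define c where "c = code_fm (rosser p q)"
  define A where "A = subst_fm 0 (num_trm c) (rosser p q)"
  have pos: "positive 0 1 p" "positive 0 1 q"
    by (simp_all add: p_def q_def diagonal_fm_def ex_defs numeral_eq_Suc)
  have p: "sat (case_nat c e) p \<longleftrightarrow> refutable A" for e
    using sat_diagonal_fm[of "rosser p q" e refutable_fm]
    by (simp add: sat_refutable_fm A_def flip: p_def c_def)
  have q: "sat (case_nat c e) q \<longleftrightarrow> refutable (Neg A)" for e
    using sat_diagonal_fm[of "rosser p q" e "\<lambda>a. refutable_fm (tImp a tFalsity)"]
    by (simp add: sat_refutable_fm[of _ _ "Neg A"] A_def Neg_def flip: q_def c_def)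
  \<comment> \<open>If either were refutable, \<open>rosser_decided\<close> would make one of
    \<open>A\<close> and \<open>Neg A\<close> both provable and refutable.\<close>
  have not_ref: "\<not> refutable A" "\<not> refutable (Neg A)"
    using rosser_decided[OF pos, of c, folded A_def, unfolded p q] provable_not_refutable by blast+
  \<comment> \<open>For \<open>Neg A\<close>, refutability concerns the double negation of
    \<open>A\<close>, so a proof of \<open>A\<close> must first be turned into a proof of
    that.\<close>
  moreover have "\<not> PA \<turnstile> A"
  proof
    assume "PA \<turnstile> A"
    then have "{Neg A} \<tturnstile> Falsity" by (intro neg_elim[OF hyps(1) provable])
    then have "PA \<turnstile> Neg (Neg A)" by (intro derives_empty neg_intro)
    with not_ref show False by (simp add: refutable_def)
  qed
  ultimately have "extremely_independent A"
    by (simp add: extremely_independent_def strongly_independent_def constructively_true_def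
      constructively_false_def refutable_def)
  moreover have "sentence A"
    using closed_rosser[of p q] pos[THEN positive_closed] unfolding sentence_def A_def
    by (simp add: closed_subst_closed_fm)
  ultimately show ?thesis by blast
qed

end
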